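(* Let $F$ be a field, $n\ge 1$, and let $c$ be a reduced skew set of degree $n$ over $F$. Then the skew matrix algebra $M_n(F;c)$ is a semiassociative $F$-central algebra, with respect to its diagonal subalgebra $\Delta=Fe_{11}+\cdots+Fe_{nn}$; that is, $M_n(F;c)$ is $\Delta$-semiassociative.
   Context: A skew set of degree $n$ over $F$ is a family $c=(c_{ijk})_{1\le i,j,k\le n}$ of scalars in $F$ (zeros allowed); it is reduced if $c_{iij}=c_{ijj}=1$ for all $i,j$. For a reduced skew set $c$, the skew matrix algebra $M_n(F;c)$ is the (in general nonassociative) $F$-algebra with basis $\{e_{ij}\}_{1\le i,j\le n}$ and multiplication $e_{ij}e_{k\ell}=\delta_{jk}c_{ij\ell}e_{i\ell}$. It is unital with $1=\sum_i e_{ii}$. The associator is $(x,y,z)=(xy)z-x(yz)$; the nucleus $\mathfrak{N}(A)$ of an algebra $A$ is the set of $x\in A$ with $(x,A,A)=(A,x,A)=(A,A,x)=0$; the center is $Z(A)=\{x\in\mathfrak{N}(A): xa=ax\text{ for all }a\in A\}$; $A$ is $F$-central if $Z(A)=F$. An étale $F$-algebra is a finite direct product of finite separable field extensions of $F$. A module over an associative ring is minimally faithful if it is faithful and has no faithful proper section (quotient of submodules). A finite dimensional $F$-central algebra $A$ is $K$-semiassociative if $K\subseteq\mathfrak{N}(A)$ is an étale $F$-subalgebra (containing $1_A$) and $A$ is minimally faithful (equivalently, faithful and cyclic) as a $K\otimes_F K$-module via $(k\otimes k')a=kak'$; it is semiassociative if this holds for some $K$. *)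

theory Defs
  imports
    "HOL-Algebra.Module"
    "HOL-Algebra.QuotRing"
    "HOL-Algebra.Generated_Groups"
    "HOL-Algebra.Free_Abelian_Groups"
    "HOL-Algebra.Polynomial_Divisibility"
    "HOL-Algebra.Finite_Extensions"
begin

section \<open>Nonassociative algebras\<close>

text \<open>
  A nonassociative algebra over the field \<open>F\<close> is represented by the library's \<open>module\<close> record,
  whose fields \<open>mult\<close> and \<open>one\<close> carry the multiplication and the unit. The library locale
  \<open>algebra\<close> covers only associative commutative algebras.
\<close>

locale unital_nonassoc_algebra = module F A + field F for F (structure) and A (structure) +
  assumes mult_closed: "\<lbrakk>x \<in> carrier A; y \<in> carrier A\<rbrakk> \<Longrightarrow> x \<otimes>\<^bsub>A\<^esub> y \<in> carrier A"
    and one_closed: "\<one>\<^bsub>A\<^esub> \<in> carrier A"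
    and mult_l_distr: "\<lbrakk>x \<in> carrier A; y \<in> carrier A; z \<in> carrier A\<rbrakk> \<Longrightarrow>
        (x \<oplus>\<^bsub>A\<^esub> y) \<otimes>\<^bsub>A\<^esub> z = x \<otimes>\<^bsub>A\<^esub> z \<oplus>\<^bsub>A\<^esub> y \<otimes>\<^bsub>A\<^esub> z"
    and mult_r_distr: "\<lbrakk>x \<in> carrier A; y \<in> carrier A; z \<in> carrier A\<rbrakk> \<Longrightarrow>
        z \<otimes>\<^bsub>A\<^esub> (x \<oplus>\<^bsub>A\<^esub> y) = z \<otimes>\<^bsub>A\<^esub> x \<oplus>\<^bsub>A\<^esub> z \<otimes>\<^bsub>A\<^esub> y"
    and smult_mult_l: "\<lbrakk>a \<in> carrier F; x \<in> carrier A; y \<in> carrier A\<rbrakk> \<Longrightarrow>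
        (a \<odot>\<^bsub>A\<^esub> x) \<otimes>\<^bsub>A\<^esub> y = a \<odot>\<^bsub>A\<^esub> (x \<otimes>\<^bsub>A\<^esub> y)"
    and smult_mult_r: "\<lbrakk>a \<in> carrier F; x \<in> carrier A; y \<in> carrier A\<rbrakk> \<Longrightarrow>
        x \<otimes>\<^bsub>A\<^esub> (a \<odot>\<^bsub>A\<^esub> y) = a \<odot>\<^bsub>A\<^esub> (x \<otimes>\<^bsub>A\<^esub> y)"
    and mult_one_l: "x \<in> carrier A \<Longrightarrow> \<one>\<^bsub>A\<^esub> \<otimes>\<^bsub>A\<^esub> x = x"
    and mult_one_r: "x \<in> carrier A \<Longrightarrow> x \<otimes>\<^bsub>A\<^esub> \<one>\<^bsub>A\<^esub> = x"

definition finite_dimensional :: "('f, 'r) ring_scheme \<Rightarrow> ('f, 'a, 'm) module_scheme \<Rightarrow> bool" where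
  "finite_dimensional F M \<longleftrightarrow>
    (\<exists>B. finite B \<and> B \<subseteq> carrier M \<and>
      (\<forall>x \<in> carrier M. \<exists>a \<in> B \<rightarrow> carrier F. x = (\<Oplus>\<^bsub>M\<^esub>b\<in>B. a b \<odot>\<^bsub>M\<^esub> b)))"

definition associator :: "('a, 'm) ring_scheme \<Rightarrow> 'a \<Rightarrow> 'a \<Rightarrow> 'a \<Rightarrow> 'a" where
  "associator A x y z = (x \<otimes>\<^bsub>A\<^esub> y) \<otimes>\<^bsub>A\<^esub> z \<ominus>\<^bsub>A\<^esub> x \<otimes>\<^bsub>A\<^esub> (y \<otimes>\<^bsub>A\<^esub> z)"

definition nucleus :: "('a, 'm) ring_scheme \<Rightarrow> 'a set" where
  "nucleus A = {x \<in> carrier A. \<forall>y \<in> carrier A. \<forall>z \<in> carrier A.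
     associator A x y z = \<zero>\<^bsub>A\<^esub> \<and> associator A y x z = \<zero>\<^bsub>A\<^esub> \<and> associator A y z x = \<zero>\<^bsub>A\<^esub>}"

definition alg_center :: "('a, 'm) ring_scheme \<Rightarrow> 'a set" where
  "alg_center A = {x \<in> nucleus A. \<forall>a \<in> carrier A. x \<otimes>\<^bsub>A\<^esub> a = a \<otimes>\<^bsub>A\<^esub> x}"

text \<open>\<open>Z(A) = F\<close>, where \<open>F\<close> is identified with its image under \<open>a \<mapsto> a 1\<close>; injectivity of
  this map excludes the zero algebra.\<close>

definition central_algebra :: "('f, 'r) ring_scheme \<Rightarrow> ('f, 'a, 'm) module_scheme \<Rightarrow> bool" where
  "central_algebra F A \<longleftrightarrow> unital_nonassoc_algebra F A \<and>
     bij_betw (\<lambda>a. a \<odot>\<^bsub>A\<^esub> \<one>\<^bsub>A\<^esub>) (carrier F) (alg_center A)"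


section \<open>Etale algebras\<close>

text \<open>Polynomials are the library's coefficient lists, highest degree first. The coefficient of
  \<open>X^i\<close> in the derivative of \<open>p\<close> is \<open>(i + 1)\<close> times that of \<open>X^(i + 1)\<close> in \<open>p\<close>;
  normalization removes the leading zeros that arise in positive characteristic.\<close>

definition poly_derivative :: "('a, 'm) ring_scheme \<Rightarrow> 'a list \<Rightarrow> 'a list" where
  "poly_derivative R p = ring.normalize R
     (map (\<lambda>i. add_pow R (Suc i) (ring.coeff R p (Suc i))) (rev [0..<length p - 1]))"

definition separable_poly :: "('a, 'm) ring_scheme \<Rightarrow> 'a set \<Rightarrow> 'a list \<Rightarrow> bool" where
  "separable_poly R K p \<longleftrightarrow>
     \<one>\<^bsub>univ_poly R K\<^esub> gcdof\<^bsub>univ_poly R K\<^esub> p (poly_derivative R p)"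

definition base_image :: "('f, 'r) ring_scheme \<Rightarrow> ('f, 'a, 'm) module_scheme \<Rightarrow> 'a set" where
  "base_image F L = (\<lambda>a. a \<odot>\<^bsub>L\<^esub> \<one>\<^bsub>L\<^esub>) ` carrier F"

definition finite_separable_extension ::
    "('f, 'r) ring_scheme \<Rightarrow> ('f, 'a, 'm) module_scheme \<Rightarrow> bool" where
  "finite_separable_extension F L \<longleftrightarrow>
     algebra F L \<and> field L \<and> finite_dimensional F L \<and>
     (\<forall>x \<in> carrier L. separable_poly L (base_image F L) (ring.Irr L (base_image F L) x))"

definition alg_prod :: "'i set \<Rightarrow> ('i \<Rightarrow> ('f, 'a) module) \<Rightarrow> ('f, 'i \<Rightarrow> 'a) module" where
  "alg_prod I L = \<lparr>
     carrier = (\<Pi>\<^sub>E i\<in>I. carrier (L i)),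
     monoid.mult = (\<lambda>x y. \<lambda>i\<in>I. x i \<otimes>\<^bsub>L i\<^esub> y i),
     one = (\<lambda>i\<in>I. \<one>\<^bsub>L i\<^esub>),
     zero = (\<lambda>i\<in>I. \<zero>\<^bsub>L i\<^esub>),
     add = (\<lambda>x y. \<lambda>i\<in>I. x i \<oplus>\<^bsub>L i\<^esub> y i),
     smult = (\<lambda>a x. \<lambda>i\<in>I. a \<odot>\<^bsub>L i\<^esub> x i)\<rparr>"

definition alg_iso ::
    "('f, 'r) ring_scheme \<Rightarrow> ('f, 'a, 'm) module_scheme \<Rightarrow> ('f, 'b, 'k) module_scheme \<Rightarrow> ('a \<Rightarrow> 'b) set"
  where
  "alg_iso F A B = {h \<in> ring_iso A B.
     \<forall>a \<in> carrier F. \<forall>x \<in> carrier A. h (a \<odot>\<^bsub>A\<^esub> x) = a \<odot>\<^bsub>B\<^esub> h x}"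

text \<open>The factors \<open>L i\<close> may be taken with elements of the same type as \<open>E\<close>, because each factor
  of a direct product decomposition of \<open>E\<close> is isomorphic to an ideal of \<open>E\<close>.\<close>

definition etale_algebra :: "('f, 'r) ring_scheme \<Rightarrow> ('f, 'a, 'm) module_scheme \<Rightarrow> bool" where
  "etale_algebra F E \<longleftrightarrow> algebra F E \<and>
     (\<exists>(m::nat) (L :: nat \<Rightarrow> ('f, 'a) module).
        (\<forall>i<m. finite_separable_extension F (L i)) \<and> alg_iso F E (alg_prod {..<m} L) \<noteq> {})"


section \<open>Minimally faithful modules\<close>

definition faithful_module :: "('r, 'm) ring_scheme \<Rightarrow> ('r, 'a, 'k) module_scheme \<Rightarrow> bool" where
  "faithful_module R M \<longleftrightarrow>
     (\<forall>r \<in> carrier R. (\<forall>x \<in> carrier M. r \<odot>\<^bsub>M\<^esub> x = \<zero>\<^bsub>M\<^esub>) \<longrightarrow> r = \<zero>\<^bsub>R\<^esub>)"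

text \<open>The section \<open>P / N\<close> of \<open>M\<close>. Its \<open>mult\<close> and \<open>one\<close> fields, which the \<open>module\<close> record
  inherits from \<open>ring\<close>, play no role.\<close>

definition module_section ::
    "('r, 'a, 'k) module_scheme \<Rightarrow> 'a set \<Rightarrow> 'a set \<Rightarrow> ('r, 'a set) module" where
  "module_section M P N = \<lparr>
     carrier = a_rcosets\<^bsub>M\<lparr>carrier := P\<rparr>\<^esub> N,
     monoid.mult = undefined,
     one = undefined,
     zero = N,
     add = set_add M,
     smult = (\<lambda>r C. \<Union>x\<in>C. N +>\<^bsub>M\<^esub> (r \<odot>\<^bsub>M\<^esub> x))\<rparr>"

definition minimally_faithful_module ::
    "('r, 'm) ring_scheme \<Rightarrow> ('r, 'a, 'k) module_scheme \<Rightarrow> bool" where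
  "minimally_faithful_module R M \<longleftrightarrow> module R M \<and> faithful_module R M \<and>
     (\<forall>P N. submodule P R M \<and> submodule N R M \<and> N \<subseteq> P \<and> faithful_module R (module_section M P N)
        \<longrightarrow> P = carrier M \<and> N = {\<zero>\<^bsub>M\<^esub>})"


section \<open>The tensor product of two algebras and its action\<close>

text \<open>The free abelian group on \<open>A \<times> B\<close> with the multiplication \<open>(a, b) (a', b') = (a a', b b')\<close>
  extended biadditively.\<close>

definition free_tensor ::
    "('f, 'a, 'm) module_scheme \<Rightarrow> ('f, 'b, 'k) module_scheme \<Rightarrow> ('a \<times> 'b \<Rightarrow>\<^sub>0 int) ring" where
  "free_tensor A B = \<lparr>
     carrier = carrier (free_Abelian_group (carrier A \<times> carrier B)),
     monoid.mult = (\<lambda>x y. frag_extend (\<lambda>(a, b).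
               frag_extend (\<lambda>(a', b'). frag_of (a \<otimes>\<^bsub>A\<^esub> a', b \<otimes>\<^bsub>B\<^esub> b')) y) x),
     one = frag_of (\<one>\<^bsub>A\<^esub>, \<one>\<^bsub>B\<^esub>),
     zero = 0,
     add = (+)\<rparr>"

definition tensor_relations ::
    "('f, 'r) ring_scheme \<Rightarrow> ('f, 'a, 'm) module_scheme \<Rightarrow> ('f, 'b, 'k) module_scheme
      \<Rightarrow> ('a \<times> 'b \<Rightarrow>\<^sub>0 int) set" where
  "tensor_relations F A B =
     {frag_of (a \<oplus>\<^bsub>A\<^esub> a', b) - frag_of (a, b) - frag_of (a', b) | a a' b.
        a \<in> carrier A \<and> a' \<in> carrier A \<and> b \<in> carrier B} \<union>
     {frag_of (a, b \<oplus>\<^bsub>B\<^esub> b') - frag_of (a, b) - frag_of (a, b') | a b b'.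
        a \<in> carrier A \<and> b \<in> carrier B \<and> b' \<in> carrier B} \<union>
     {frag_of (r \<odot>\<^bsub>A\<^esub> a, b) - frag_of (a, r \<odot>\<^bsub>B\<^esub> b) | r a b.
        r \<in> carrier F \<and> a \<in> carrier A \<and> b \<in> carrier B}"

text \<open>The additive subgroup generated by the relations is an ideal of \<open>free_tensor A B\<close>, since
  multiplying a relation by a generator \<open>(a, b)\<close> gives a relation of the same kind.\<close>

definition tensor_ring ::
    "('f, 'r) ring_scheme \<Rightarrow> ('f, 'a, 'm) module_scheme \<Rightarrow> ('f, 'b, 'k) module_scheme
      \<Rightarrow> (('a \<times> 'b \<Rightarrow>\<^sub>0 int) set) ring" where
  "tensor_ring F A B =
     free_tensor A B Quot generate (add_monoid (free_tensor A B)) (tensor_relations F A B)"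

definition free_bimodule_action ::
    "('f, 'a, 'm) module_scheme \<Rightarrow> ('a \<times> 'a \<Rightarrow>\<^sub>0 int) \<Rightarrow> 'a \<Rightarrow> 'a" where
  "free_bimodule_action A t a =
     (\<Oplus>\<^bsub>A\<^esub>p \<in> Poly_Mapping.keys t.
        add_pow A (Poly_Mapping.lookup t p) ((fst p \<otimes>\<^bsub>A\<^esub> a) \<otimes>\<^bsub>A\<^esub> snd p))"

text \<open>\<open>A\<close> as a module over \<open>K \<otimes> K\<close> through \<open>(k \<otimes> k') a = k a k'\<close>. Scalars are cosets, and every
  representative acts in the same way when \<open>K\<close> is a subalgebra contained in the nucleus.\<close>

definition bimodule :: "('f, 'a, 'm) module_scheme \<Rightarrow> (('a \<times> 'a \<Rightarrow>\<^sub>0 int) set, 'a) module" where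
  "bimodule A = \<lparr>
     carrier = carrier A,
     monoid.mult = monoid.mult A,
     one = one A,
     zero = zero A,
     add = add A,
     smult = (\<lambda>C a. the_elem ((\<lambda>t. free_bimodule_action A t a) ` C))\<rparr>"


section \<open>Semiassociative algebras\<close>

definition semiassociative_wrt ::
    "('f, 'r) ring_scheme \<Rightarrow> ('f, 'a, 'm) module_scheme \<Rightarrow> 'a set \<Rightarrow> bool" where
  "semiassociative_wrt F A K \<longleftrightarrow>
     central_algebra F A \<and> finite_dimensional F A \<and>
     K \<subseteq> nucleus A \<and> \<one>\<^bsub>A\<^esub> \<in> K \<and> etale_algebra F (A\<lparr>carrier := K\<rparr>) \<and>
     minimally_faithful_module (tensor_ring F (A\<lparr>carrier := K\<rparr>) (A\<lparr>carrier := K\<rparr>)) (bimodule A)"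


section \<open>Skew matrix algebras\<close>

definition skew_set :: "('f, 'r) ring_scheme \<Rightarrow> nat \<Rightarrow> (nat \<Rightarrow> nat \<Rightarrow> nat \<Rightarrow> 'f) \<Rightarrow> bool" where
  "skew_set F n c \<longleftrightarrow> (\<forall>i\<in>{1..n}. \<forall>j\<in>{1..n}. \<forall>k\<in>{1..n}. c i j k \<in> carrier F)"

definition reduced_skew_set :: "('f, 'r) ring_scheme \<Rightarrow> nat \<Rightarrow> (nat \<Rightarrow> nat \<Rightarrow> nat \<Rightarrow> 'f) \<Rightarrow> bool" where
  "reduced_skew_set F n c \<longleftrightarrow> skew_set F n c \<and>
     (\<forall>i\<in>{1..n}. \<forall>j\<in>{1..n}. c i i j = \<one>\<^bsub>F\<^esub> \<and> c i j j = \<one>\<^bsub>F\<^esub>)"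

text \<open>An element is the family of its coordinates with respect to the basis of matrix units.\<close>

definition skew_matrix_algebra ::
    "('f, 'r) ring_scheme \<Rightarrow> nat \<Rightarrow> (nat \<Rightarrow> nat \<Rightarrow> nat \<Rightarrow> 'f) \<Rightarrow> ('f, nat \<times> nat \<Rightarrow> 'f) module" where
  "skew_matrix_algebra F n c = \<lparr>
     carrier = {1..n} \<times> {1..n} \<rightarrow>\<^sub>E carrier F,
     monoid.mult = (\<lambda>x y. \<lambda>(i, l) \<in> {1..n} \<times> {1..n}.
               \<Oplus>\<^bsub>F\<^esub>j\<in>{1..n}. c i j l \<otimes>\<^bsub>F\<^esub> (x (i, j) \<otimes>\<^bsub>F\<^esub> y (j, l))),
     one = (\<lambda>(i, j) \<in> {1..n} \<times> {1..n}. if i = j then \<one>\<^bsub>F\<^esub> else \<zero>\<^bsub>F\<^esub>),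
     zero = (\<lambda>p \<in> {1..n} \<times> {1..n}. \<zero>\<^bsub>F\<^esub>),
     add = (\<lambda>x y. \<lambda>p \<in> {1..n} \<times> {1..n}. x p \<oplus>\<^bsub>F\<^esub> y p),
     smult = (\<lambda>a x. \<lambda>p \<in> {1..n} \<times> {1..n}. a \<otimes>\<^bsub>F\<^esub> x p)\<rparr>"

definition matrix_unit :: "('f, 'r) ring_scheme \<Rightarrow> nat \<Rightarrow> nat \<Rightarrow> nat \<Rightarrow> nat \<times> nat \<Rightarrow> 'f" where
  "matrix_unit F n i j = (\<lambda>p \<in> {1..n} \<times> {1..n}. if p = (i, j) then \<one>\<^bsub>F\<^esub> else \<zero>\<^bsub>F\<^esub>)"

definition diagonal_subalgebra ::
    "('f, 'r) ring_scheme \<Rightarrow> nat \<Rightarrow> (nat \<Rightarrow> nat \<Rightarrow> nat \<Rightarrow> 'f) \<Rightarrow> (nat \<times> nat \<Rightarrow> 'f) set" where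
  "diagonal_subalgebra F n c =
     {\<Oplus>\<^bsub>skew_matrix_algebra F n c\<^esub>i\<in>{1..n}. d i \<odot>\<^bsub>skew_matrix_algebra F n c\<^esub> matrix_unit F n i i | d.
        d \<in> {1..n} \<rightarrow> carrier F}"

text \<open>The defining multiplication rule of the basis.\<close>

lemma matrix_unit_mult:
  assumes "field F" "skew_set F n c"
    and "i \<in> {1..n}" "j \<in> {1..n}" "k \<in> {1..n}" "l \<in> {1..n}"
  shows "matrix_unit F n i j \<otimes>\<^bsub>skew_matrix_algebra F n c\<^esub> matrix_unit F n k l =
     (if j = k then c i j l \<odot>\<^bsub>skew_matrix_algebra F n c\<^esub> matrix_unit F n i l
      else \<zero>\<^bsub>skew_matrix_algebra F n c\<^esub>)"
proof -
  interpret field F by fact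
  have c: "c p q r \<in> carrier F" if "p \<in> {1..n}" "q \<in> {1..n}" "r \<in> {1..n}" for p q r
    using assms(2) that unfolding skew_set_def by blast
  have sum: "(\<Oplus>\<^bsub>F\<^esub>q\<in>{1..n}. c p q r \<otimes>\<^bsub>F\<^esub>
       (matrix_unit F n i j (p, q) \<otimes>\<^bsub>F\<^esub> matrix_unit F n k l (q, r)))
     = (if j = k \<and> p = i \<and> r = l then c i j l else \<zero>\<^bsub>F\<^esub>)"
    if p: "p \<in> {1..n}" and r: "r \<in> {1..n}" for p r
  proof -
    have "(\<Oplus>\<^bsub>F\<^esub>q\<in>{1..n}. c p q r \<otimes>\<^bsub>F\<^esub>
        (matrix_unit F n i j (p, q) \<otimes>\<^bsub>F\<^esub> matrix_unit F n k l (q, r)))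
      = (\<Oplus>\<^bsub>F\<^esub>q\<in>{1..n}. if j = q then (if j = k \<and> p = i \<and> r = l then c i j l else \<zero>\<^bsub>F\<^esub>) else \<zero>\<^bsub>F\<^esub>)"
      by (rule add.finprod_cong') (use p r assms c in \<open>auto simp: matrix_unit_def\<close>)
    also have "\<dots> = (if j = k \<and> p = i \<and> r = l then c i j l else \<zero>\<^bsub>F\<^esub>)"
      using add.finprod_singleton[of j "{1..n}"
          "\<lambda>_. if j = k \<and> p = i \<and> r = l then c i j l else \<zero>\<^bsub>F\<^esub>"] assms c by auto
    finally show ?thesis .
  qed
  show ?thesis
  proof (rule ext)
    fix p :: "nat \<times> nat"
    obtain a b where p: "p = (a, b)" by (cases p)
    show "(matrix_unit F n i j \<otimes>\<^bsub>skew_matrix_algebra F n c\<^esub> matrix_unit F n k l) p =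
      (if j = k then c i j l \<odot>\<^bsub>skew_matrix_algebra F n c\<^esub> matrix_unit F n i l
       else \<zero>\<^bsub>skew_matrix_algebra F n c\<^esub>) p"
    proof (cases "a \<in> {1..n} \<and> b \<in> {1..n}")
      case True
      have "(matrix_unit F n i j \<otimes>\<^bsub>skew_matrix_algebra F n c\<^esub> matrix_unit F n k l) p
          = (if j = k \<and> a = i \<and> b = l then c i j l else \<zero>\<^bsub>F\<^esub>)"
        using sum[of a b] True by (simp add: p skew_matrix_algebra_def del: One_nat_def)
      moreover have "c i j l \<in> carrier F" using c assms by blast
      ultimately show ?thesis
        using True by (auto simp: p skew_matrix_algebra_def matrix_unit_def)
    next
      case False
      then show ?thesis by (auto simp: p skew_matrix_algebra_def)
    qed
  qed
qed

end

theory Submission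
  imports Defs
begin

text \<open>
  Let \<open>K\<close> be the diagonal. Reducedness makes left and right multiplication by a diagonal element
  scale rows and columns without any factor \<open>c\<close>, whence \<open>K\<close> lies in the nucleus; commuting with
  all matrix units forces an element to be scalar.

  The map \<open>a \<otimes> b \<mapsto> (a\<^sub>i b\<^sub>j)\<close> identifies \<open>K \<otimes> K\<close> with the algebra \<open>Q\<close> of all families
  \<open>(s\<^sub>i\<^sub>j)\<close> under the entrywise product, and under this identification \<open>K \<otimes> K\<close> acts on the
  matrices by the entrywise product, so faithfulness is clear. If a section \<open>P / N\<close> is faithful, the
  idempotent \<open>e\<^sub>i\<^sub>j\<close> of \<open>Q\<close> does not annihilate it, so some \<open>x \<in> P\<close> has \<open>x\<^sub>i\<^sub>j e\<^sub>i\<^sub>j \<notin> N\<close>.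
  Hence \<open>F e\<^sub>i\<^sub>j\<close> is contained in \<open>P\<close>, while no element of \<open>N\<close> has a nonzero \<open>(i, j)\<close> entry;
  thus \<open>P\<close> is everything and \<open>N = 0\<close>.
\<close>

section \<open>Algebras of functions\<close>

text \<open>The power \<open>F^S\<close> with entrywise operations. On the set of index pairs it is
  both the linear space underlying the skew algebra and the target of \<open>K \<otimes> K\<close>;
  on a single point it is a copy of \<open>F\<close>.\<close>

definition function_algebra ::
    "('f, 'r) ring_scheme \<Rightarrow> 'i set \<Rightarrow> ('f, 'i \<Rightarrow> 'f) module" where
  "function_algebra F S = \<lparr>
     carrier = S \<rightarrow>\<^sub>E carrier F,
     monoid.mult = (\<lambda>x y. \<lambda>s\<in>S. x s \<otimes>\<^bsub>F\<^esub> y s),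
     one = (\<lambda>s\<in>S. \<one>\<^bsub>F\<^esub>),
     zero = (\<lambda>s\<in>S. \<zero>\<^bsub>F\<^esub>),
     add = (\<lambda>x y. \<lambda>s\<in>S. x s \<oplus>\<^bsub>F\<^esub> y s),
     smult = (\<lambda>a x. \<lambda>s\<in>S. a \<otimes>\<^bsub>F\<^esub> x s)\<rparr>"

definition delta_function :: "('f, 'r) ring_scheme \<Rightarrow> 'i set \<Rightarrow> 'i \<Rightarrow> 'i \<Rightarrow> 'f" where
  "delta_function F S s = (\<lambda>p\<in>S. if p = s then \<one>\<^bsub>F\<^esub> else \<zero>\<^bsub>F\<^esub>)"

lemma function_algebra_carrier: "carrier (function_algebra F S) = S \<rightarrow>\<^sub>E carrier F"
  by (simp add: function_algebra_def)

lemma function_algebra_simps: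
  assumes "s \<in> S"
  shows "(x \<otimes>\<^bsub>function_algebra F S\<^esub> y) s = x s \<otimes>\<^bsub>F\<^esub> y s"
    and "\<one>\<^bsub>function_algebra F S\<^esub> s = \<one>\<^bsub>F\<^esub>"
    and "\<zero>\<^bsub>function_algebra F S\<^esub> s = \<zero>\<^bsub>F\<^esub>"
    and "(x \<oplus>\<^bsub>function_algebra F S\<^esub> y) s = x s \<oplus>\<^bsub>F\<^esub> y s"
    and "(a \<odot>\<^bsub>function_algebra F S\<^esub> x) s = a \<otimes>\<^bsub>F\<^esub> x s"
  using assms by (auto simp: function_algebra_def)

lemma function_algebra_eqI:
  assumes "x \<in> carrier (function_algebra F S)" "y \<in> carrier (function_algebra F S)"
    and "\<And>s. s \<in> S \<Longrightarrow> x s = y s"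
  shows "x = y"
  using assms PiE_ext unfolding function_algebra_carrier by blast

lemma (in cring) algebra_function_algebra: "algebra R (function_algebra R S)"
proof -
  let ?Q = "function_algebra R S"
  have ab: "abelian_group ?Q"
  proof (rule abelian_groupI)
    fix x assume x: "x \<in> carrier ?Q"
    have "(\<lambda>s\<in>S. \<ominus> x s) \<in> carrier ?Q" "(\<lambda>s\<in>S. \<ominus> x s) \<oplus>\<^bsub>?Q\<^esub> x = \<zero>\<^bsub>?Q\<^esub>"
      using x by (auto simp: function_algebra_def PiE_iff l_neg)
    then show "\<exists>y\<in>carrier ?Q. y \<oplus>\<^bsub>?Q\<^esub> x = \<zero>\<^bsub>?Q\<^esub>" by blast
  qed (auto simp: function_algebra_def PiE_iff extensional_def fun_eq_iff a_ac)
  have cm: "comm_monoid ?Q"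
    by (rule comm_monoidI)
      (auto simp: function_algebra_def PiE_iff extensional_def fun_eq_iff m_ac)
  have "cring ?Q"
    by (rule cringI[OF ab cm]) (auto simp: function_algebra_def PiE_iff fun_eq_iff l_distr)
  then show ?thesis
    by (intro algebraI)
      (auto simp: function_algebra_def PiE_iff extensional_def fun_eq_iff l_distr r_distr m_assoc
         is_cring)
qed

lemma (in cring) function_algebra_finsum:
  assumes "finite A" "f \<in> A \<rightarrow> carrier (function_algebra R S)" "s \<in> S"
  shows "(\<Oplus>\<^bsub>function_algebra R S\<^esub>a\<in>A. f a) s = (\<Oplus>a\<in>A. f a s)"
proof -
  interpret Q: algebra R "function_algebra R S" by (rule algebra_function_algebra)
  show ?thesis using assms
  proof (induction A rule: finite_induct)
    case (insert a A)
    then have "f b s \<in> carrier R" if "b \<in> insert a A" for b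
      using that by (auto simp: function_algebra_carrier PiE_iff Pi_iff)
    with insert show ?case
      by (auto simp: function_algebra_simps)
  qed (simp add: function_algebra_simps)
qed

lemma (in cring) delta_function_closed: "delta_function R S s \<in> carrier (function_algebra R S)"
  by (auto simp: delta_function_def function_algebra_carrier)

lemma (in cring) function_algebra_expansion:
  assumes "finite S" "d \<in> S \<rightarrow> carrier R" "T \<subseteq> S"
  shows "(\<Oplus>\<^bsub>function_algebra R S\<^esub>t\<in>T. d t \<odot>\<^bsub>function_algebra R S\<^esub> delta_function R S t) =
    (\<lambda>s\<in>S. if s \<in> T then d s else \<zero>)"
proof -
  let ?Q = "function_algebra R S"
  interpret Q: algebra R ?Q by (rule algebra_function_algebra)
  have fin: "finite T" using assms finite_subset by auto
  have cl: "(\<lambda>t. d t \<odot>\<^bsub>?Q\<^esub> delta_function R S t) \<in> T \<rightarrow> carrier ?Q"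
    using assms by (auto intro!: Q.smult_closed delta_function_closed)
  show ?thesis
  proof (rule function_algebra_eqI)
    show "(\<Oplus>\<^bsub>?Q\<^esub>t\<in>T. d t \<odot>\<^bsub>?Q\<^esub> delta_function R S t) \<in> carrier ?Q"
      using cl by (rule Q.M.finsum_closed)
    show "(\<lambda>s\<in>S. if s \<in> T then d s else \<zero>) \<in> carrier ?Q"
      using assms by (auto simp: function_algebra_carrier)
    fix s assume s: "s \<in> S"
    have "(\<Oplus>\<^bsub>?Q\<^esub>t\<in>T. d t \<odot>\<^bsub>?Q\<^esub> delta_function R S t) s
        = (\<Oplus>t\<in>T. (d t \<odot>\<^bsub>?Q\<^esub> delta_function R S t) s)"
      by (rule function_algebra_finsum[OF fin cl s])
    also have "\<dots> = (\<Oplus>t\<in>T. if s = t then d t else \<zero>)"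
      by (rule add.finprod_cong') (use assms s in \<open>auto simp: function_algebra_simps delta_function_def Pi_iff subset_iff\<close>)
    also have "\<dots> = (if s \<in> T then d s else \<zero>)"
    proof (cases "s \<in> T")
      case True
      then show ?thesis using add.finprod_singleton[OF True fin, of d] assms by auto
    next
      case False
      then have "(\<Oplus>t\<in>T. if s = t then d t else \<zero>) = (\<Oplus>t\<in>T. \<zero>)"
        by (intro add.finprod_cong') auto
      then show ?thesis using False by simp
    qed
    finally show "(\<Oplus>\<^bsub>?Q\<^esub>t\<in>T. d t \<odot>\<^bsub>?Q\<^esub> delta_function R S t) s =
        (\<lambda>s\<in>S. if s \<in> T then d s else \<zero>) s" using s by simp
  qed
qed

lemma (in field) finite_dimensional_function_algebra:
  assumes "finite S"
  shows "finite_dimensional R (function_algebra R S)"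
proof -
  let ?Q = "function_algebra R S" and ?e = "delta_function R S"
  interpret Q: algebra R ?Q by (rule algebra_function_algebra)
  have inj: "inj_on ?e S"
  proof (rule inj_onI)
    fix s t assume "s \<in> S" "t \<in> S" "?e s = ?e t"
    then have "?e s s = ?e t s" "s \<in> S" by simp_all
    then show "s = t" using one_not_zero
      by (auto simp: delta_function_def split: if_splits)
  qed
  have "\<exists>a \<in> ?e ` S \<rightarrow> carrier R. x = (\<Oplus>\<^bsub>?Q\<^esub>b\<in>?e ` S. a b \<odot>\<^bsub>?Q\<^esub> b)" if x: "x \<in> carrier ?Q" for x
  proof (rule bexI)
    \<comment> \<open>\<open>finite_dimensional\<close> indexes coefficients by the spanning vectors
      themselves, so the point \<open>s\<close> has to be recovered from its delta function;
      injectivity of \<open>?e\<close> on \<open>S\<close> makes this well defined.\<close>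
    let ?a = "\<lambda>b. x (inv_into S ?e b)"
    have xs: "x s \<in> carrier R" if "s \<in> S" for s
      using x that by (auto simp: function_algebra_carrier)
    show a: "?a \<in> ?e ` S \<rightarrow> carrier R"
      using inj xs by (auto simp: inv_into_f_f)
    have "(\<Oplus>\<^bsub>?Q\<^esub>b\<in>?e ` S. ?a b \<odot>\<^bsub>?Q\<^esub> b) = (\<Oplus>\<^bsub>?Q\<^esub>s\<in>S. ?a (?e s) \<odot>\<^bsub>?Q\<^esub> ?e s)"
      using a inj xs by (intro Q.M.add.finprod_reindex) (auto intro!: Q.smult_closed delta_function_closed)
    also have "\<dots> = (\<Oplus>\<^bsub>?Q\<^esub>s\<in>S. x s \<odot>\<^bsub>?Q\<^esub> ?e s)"
      using inj xs by (intro Q.M.add.finprod_cong') (auto intro!: Q.smult_closed delta_function_closed simp: inv_into_f_f)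
    also have "\<dots> = (\<lambda>s\<in>S. x s)"
      using function_algebra_expansion[OF assms, of x S] xs
      by (auto cong: restrict_cong)
    also have "\<dots> = x"
      using x by (simp add: function_algebra_carrier PiE_restrict)
    finally show "x = (\<Oplus>\<^bsub>?Q\<^esub>b\<in>?e ` S. ?a b \<odot>\<^bsub>?Q\<^esub> b)" by simp
  qed
  then show ?thesis
    using assms delta_function_closed unfolding finite_dimensional_def
    by (intro exI[of _ "?e ` S"]) auto
qed

section \<open>One-point function algebras as trivial separable extensions\<close>

lemma (in field) field_function_algebra_singleton: "field (function_algebra R {s})"
proof -
  let ?L = "function_algebra R {s}"
  interpret L: algebra R ?L by (rule algebra_function_algebra)
  have "\<exists>y\<in>carrier ?L. x \<otimes>\<^bsub>?L\<^esub> y = \<one>\<^bsub>?L\<^esub>" if x: "x \<in> carrier ?L" "x \<noteq> \<zero>\<^bsub>?L\<^esub>" for x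
  proof -
    have "x s \<in> carrier R"
      using x by (auto simp: function_algebra_carrier)
    moreover have "x s \<noteq> \<zero>"
      using x function_algebra_eqI[OF x(1) L.M.zero_closed] by (auto simp: function_algebra_simps)
    ultimately have u: "x s \<in> Units R" by (simp add: field_Units)
    then have "(\<lambda>t\<in>{s}. inv (x s)) \<in> carrier ?L" "x \<otimes>\<^bsub>?L\<^esub> (\<lambda>t\<in>{s}. inv (x s)) = \<one>\<^bsub>?L\<^esub>"
      by (auto simp: function_algebra_def)
    then show ?thesis by blast
  qed
  moreover have "\<zero>\<^bsub>?L\<^esub> \<noteq> \<one>\<^bsub>?L\<^esub>"
    by (metis function_algebra_simps(2,3) insertI1 one_not_zero)
  ultimately show ?thesis by (intro cring.cring_fieldI2[OF L.M_cring]) auto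
qed

text \<open>Over the whole field \<open>x\<close> is a root of the monic polynomial
  \<open>X - x\<close>, which is irreducible because its degree is one; uniqueness of the minimal
  polynomial does the rest.\<close>

lemma (in field) Irr_carrier:
  assumes x: "x \<in> carrier R"
  shows "Irr (carrier R) x = [\<one>, \<ominus> x]"
proof -
  let ?p = "[\<one>, \<ominus> x]"
  have p: "?p \<in> carrier (univ_poly R (carrier R))"
    using x by (auto simp: univ_poly_carrier[symmetric] polynomial_def)
  have ev: "eval ?p x = \<zero>" using x by (simp add: r_neg)
  have "(algebraic over carrier R) x"
    using algebraicI[OF p _ ev] by simp
  from minimal_polynomial_is_unique[OF carrier_is_subfield x this]
  show ?thesis unfolding Irr_def
    using p ev degree_one_imp_pirreducible[OF carrier_is_subfield p] by (intro the1_equality) auto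
qed

text \<open>The derivative of \<open>X - x\<close> is the constant 1 in every characteristic, and 1
  is coprime to anything.\<close>

lemma (in field) separable_Irr_carrier:
  assumes x: "x \<in> carrier R"
  shows "separable_poly R (carrier R) (Irr (carrier R) x)"
proof -
  let ?P = "univ_poly R (carrier R)" and ?p = "[\<one>, \<ominus> x]"
  interpret P: cring ?P using univ_poly_is_cring[OF carrier_is_subring] .
  have p: "?p \<in> carrier ?P"
    using x by (auto simp: univ_poly_carrier[symmetric] polynomial_def)
  have "poly_derivative R ?p = \<one>\<^bsub>?P\<^esub>"
    by (simp add: poly_derivative_def univ_poly_one)
  moreover have "\<one>\<^bsub>?P\<^esub> gcdof\<^bsub>?P\<^esub> ?p \<one>\<^bsub>?P\<^esub>"
    using p by (intro P.isgcd_divides_r P.unit_divides) auto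
  ultimately show ?thesis by (simp add: Irr_carrier[OF x] separable_poly_def)
qed

lemma (in field) finite_separable_function_algebra_singleton:
  "finite_separable_extension R (function_algebra R {s})"
proof -
  let ?L = "function_algebra R {s}"
  interpret L: field ?L by (rule field_function_algebra_singleton)
  interpret A: algebra R ?L by (rule algebra_function_algebra)
  \<comment> \<open>On one point every function is a multiple of the unit, so the image of the base
    field is all of \<open>?L\<close> and the minimal polynomials over it are linear.\<close>
  have "x \<in> base_image R ?L" if "x \<in> carrier ?L" for x
    unfolding base_image_def
  proof (rule image_eqI)
    show "x s \<in> carrier R" using that by (auto simp: function_algebra_carrier)
    then show "x = x s \<odot>\<^bsub>?L\<^esub> \<one>\<^bsub>?L\<^esub>"
      using that by (auto simp: function_algebra_def PiE_iff extensional_def)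
  qed
  then have "base_image R ?L = carrier ?L"
    by (auto simp: base_image_def intro: A.smult_closed)
  then show ?thesis
    using L.separable_Irr_carrier
    by (simp add: finite_separable_extension_def algebra_function_algebra L.field_axioms
        finite_dimensional_function_algebra)
qed

section \<open>Free abelian groups and the free tensor ring\<close>

text \<open>The additive map out of the free abelian group that sends each generator
  \<open>p\<close> to \<open>f p\<close>. Both \<open>entry_map\<close> and
  \<open>free_bimodule_action\<close> are of this form.\<close>

definition frag_eval :: "('a, 'm) ring_scheme \<Rightarrow> ('b \<Rightarrow> 'a) \<Rightarrow> ('b \<Rightarrow>\<^sub>0 int) \<Rightarrow> 'a" where
  "frag_eval G f t = (\<Oplus>\<^bsub>G\<^esub>p\<in>Poly_Mapping.keys t. add_pow G (Poly_Mapping.lookup t p) (f p))"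

text \<open>Evaluation uses addition only, so it can be moved between algebras that share the
  additive group but not the product.\<close>

lemma frag_eval_cong_add_monoid:
  assumes "add_monoid G = add_monoid H"
  shows "frag_eval G f t = frag_eval H f t"
  using assms by (simp add: frag_eval_def finsum_def add_pow_def)

context abelian_group
begin

text \<open>Points outside the support have coefficient 0 and contribute nothing. A larger index set
  allows several formal sums to be evaluated over one common set, although cancellation may shrink
  the support of their sum.\<close>

lemma frag_eval_superset:
  assumes "f \<in> S \<rightarrow> carrier G" "Poly_Mapping.keys t \<subseteq> B" "finite B" "B \<subseteq> S"
  shows "frag_eval G f t = (\<Oplus>p\<in>B. add_pow G (Poly_Mapping.lookup t p) (f p))"
proof -
  have zero: "add_pow G (0::int) x = \<zero>" for x by (simp add: add_pow_def)
  show ?thesis unfolding frag_eval_def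
    by (rule add.finprod_mono_neutral_cong_left)
      (use assms in \<open>auto simp: Pi_iff in_keys_iff subset_iff zero\<close>)
qed

lemma frag_eval_zero [simp]: "frag_eval G f 0 = \<zero>"
  by (simp add: frag_eval_def)

lemma frag_eval_of [simp]:
  assumes "f p \<in> carrier G"
  shows "frag_eval G f (frag_of p) = f p"
  using assms by (simp add: frag_eval_def add.int_pow_1)

lemma frag_eval_closed [intro]:
  assumes "f \<in> S \<rightarrow> carrier G" "Poly_Mapping.keys t \<subseteq> S"
  shows "frag_eval G f t \<in> carrier G"
  unfolding frag_eval_def by (rule finsum_closed) (use assms in auto)

lemma frag_eval_add:
  assumes f: "f \<in> S \<rightarrow> carrier G"
    and t: "Poly_Mapping.keys t \<subseteq> S" and u: "Poly_Mapping.keys u \<subseteq> S"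
  shows "frag_eval G f (t + u) = frag_eval G f t \<oplus> frag_eval G f u"
proof -
  let ?B = "Poly_Mapping.keys t \<union> Poly_Mapping.keys u"
  have fB: "f p \<in> carrier G" if "p \<in> ?B" for p using f t u that by blast
  have "frag_eval G f (t + u) = (\<Oplus>p\<in>?B. add_pow G (Poly_Mapping.lookup (t + u) p) (f p))"
    using t u keys_add[of t u] by (intro frag_eval_superset[OF f]) auto
  also have "\<dots> = (\<Oplus>p\<in>?B. add_pow G (Poly_Mapping.lookup t p) (f p) \<oplus>
      add_pow G (Poly_Mapping.lookup u p) (f p))"
    using fB by (intro add.finprod_cong') (auto simp: lookup_add add.int_pow_mult)
  also have "\<dots> = (\<Oplus>p\<in>?B. add_pow G (Poly_Mapping.lookup t p) (f p)) \<oplus>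
      (\<Oplus>p\<in>?B. add_pow G (Poly_Mapping.lookup u p) (f p))"
    using fB by (intro finsum_addf) auto
  also have "\<dots> = frag_eval G f t \<oplus> frag_eval G f u"
    using frag_eval_superset[OF f, of t ?B] frag_eval_superset[OF f, of u ?B] t u by simp
  finally show ?thesis .
qed

lemma frag_eval_diff:
  assumes f: "f \<in> S \<rightarrow> carrier G"
    and t: "Poly_Mapping.keys t \<subseteq> S" and u: "Poly_Mapping.keys u \<subseteq> S"
  shows "frag_eval G f (t - u) = frag_eval G f t \<ominus> frag_eval G f u"
proof -
  have tu: "Poly_Mapping.keys (t - u) \<subseteq> S" using keys_diff[of t u] t u by blast
  note cl = frag_eval_closed[OF f t] frag_eval_closed[OF f u] frag_eval_closed[OF f tu]
  have "frag_eval G f t = frag_eval G f (t - u) \<oplus> frag_eval G f u"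
    using frag_eval_add[OF f tu u] by simp
  then show ?thesis using cl by (simp add: minus_eq a_assoc r_neg)
qed

end

text \<open>The product of \<open>free_tensor\<close> nests two uses of \<open>frag_extend\<close>.
  Its additivity in the right factor requires \<open>frag_extend\<close> to be additive in the
  function that it extends; this lemma and the next two supply that.\<close>

lemma frag_extend_distrib: "frag_extend (\<lambda>p. f p + g p) x = frag_extend f x + frag_extend g x"
  by (induction x rule: frag_induction[OF subset_UNIV]) (auto simp: frag_extend_diff)

lemma frag_extend_diff_distrib: "frag_extend (\<lambda>p. f p - g p) x = frag_extend f x - frag_extend g x"
  by (induction x rule: frag_induction[OF subset_UNIV]) (auto simp: frag_extend_diff)

lemma frag_extend_zero: "frag_extend (\<lambda>p. 0) x = 0"
  by (simp add: frag_extend_eq_0)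

section \<open>The ring of formal sums of pairs\<close>

lemma free_tensor_carrier:
  "t \<in> carrier (free_tensor A B) \<longleftrightarrow> Poly_Mapping.keys t \<subseteq> carrier A \<times> carrier B"
  by (simp add: free_tensor_def)

lemma free_tensor_simps:
  "\<one>\<^bsub>free_tensor A B\<^esub> = frag_of (\<one>\<^bsub>A\<^esub>, \<one>\<^bsub>B\<^esub>)"
  "\<zero>\<^bsub>free_tensor A B\<^esub> = 0"
  "x \<oplus>\<^bsub>free_tensor A B\<^esub> y = x + y"
  by (simp_all add: free_tensor_def)

lemma free_tensor_mult_of:
  "frag_of (a, b) \<otimes>\<^bsub>free_tensor A B\<^esub> frag_of (a', b') = frag_of (a \<otimes>\<^bsub>A\<^esub> a', b \<otimes>\<^bsub>B\<^esub> b')"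
  by (simp add: free_tensor_def)

lemma free_tensor_mult_linear:
  "0 \<otimes>\<^bsub>free_tensor A B\<^esub> y = 0"
  "x \<otimes>\<^bsub>free_tensor A B\<^esub> 0 = 0"
  "(x + x') \<otimes>\<^bsub>free_tensor A B\<^esub> y = x \<otimes>\<^bsub>free_tensor A B\<^esub> y + x' \<otimes>\<^bsub>free_tensor A B\<^esub> y"
  "(x - x') \<otimes>\<^bsub>free_tensor A B\<^esub> y = x \<otimes>\<^bsub>free_tensor A B\<^esub> y - x' \<otimes>\<^bsub>free_tensor A B\<^esub> y"
  "x \<otimes>\<^bsub>free_tensor A B\<^esub> (y + y') = x \<otimes>\<^bsub>free_tensor A B\<^esub> y + x \<otimes>\<^bsub>free_tensor A B\<^esub> y'"
  "x \<otimes>\<^bsub>free_tensor A B\<^esub> (y - y') = x \<otimes>\<^bsub>free_tensor A B\<^esub> y - x \<otimes>\<^bsub>free_tensor A B\<^esub> y'"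
  by (simp_all add: free_tensor_def frag_extend_add frag_extend_diff case_prod_unfold
      frag_extend_distrib frag_extend_diff_distrib frag_extend_zero)

lemma abelian_group_free_tensor: "abelian_group (free_tensor A B)"
proof -
  have "add_monoid (free_tensor A B) = free_Abelian_group (carrier A \<times> carrier B)"
    by (simp add: free_tensor_def free_Abelian_group_def)
  then show ?thesis
    using abelian_free_Abelian_group[of "carrier A \<times> carrier B"]
    by (simp add: abelian_group.intro abelian_group_axioms.intro abelian_monoid.intro comm_group_def)
qed

lemma free_tensor_minus:
  assumes "x \<in> carrier (free_tensor A B)" "y \<in> carrier (free_tensor A B)"
  shows "x \<ominus>\<^bsub>free_tensor A B\<^esub> y = x - y"
proof -
  interpret T: abelian_group "free_tensor A B" by (rule abelian_group_free_tensor)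
  have "- y \<in> carrier (free_tensor A B)" using assms by (simp add: free_tensor_carrier)
  then have "\<ominus>\<^bsub>free_tensor A B\<^esub> y = - y"
    using assms by (intro T.minus_equality) (auto simp: free_tensor_simps)
  then show ?thesis by (simp add: T.minus_eq free_tensor_simps)
qed

text \<open>Pairs generate the group, and closure under differences covers sums and negatives at
  once. An identity that is additive in a variable then has to be checked on pairs only.\<close>

lemma free_tensor_induct [consumes 1, case_names zero of diff]:
  assumes "x \<in> carrier (free_tensor A B)"
    and "P 0"
    and "\<And>a b. a \<in> carrier A \<Longrightarrow> b \<in> carrier B \<Longrightarrow> P (frag_of (a, b))"
    and "\<And>x y. x \<in> carrier (free_tensor A B) \<Longrightarrow> y \<in> carrier (free_tensor A B) \<Longrightarrow>
      P x \<Longrightarrow> P y \<Longrightarrow> P (x - y)"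
  shows "P x"
  using assms(1) unfolding free_tensor_carrier
  by (induction rule: free_Abelian_group_induct) (use assms in \<open>auto simp: free_tensor_carrier\<close>)

text \<open>This is the integral monoid ring of the multiplicative monoid
  \<open>A \<times> B\<close>. The ring laws are additive in each variable, so they reduce, one
  variable at a time, to pairs, where they are the laws of \<open>A\<close> and
  \<open>B\<close>.\<close>

lemma cring_free_tensor:
  assumes "cring A" "cring B"
  shows "cring (free_tensor A B)"
proof -
  let ?T = "free_tensor A B"
  interpret A: cring A by fact
  interpret B: cring B by fact
  note lin = free_tensor_mult_linear free_tensor_mult_of
  have diff: "x - y \<in> carrier ?T" if "x \<in> carrier ?T" "y \<in> carrier ?T" for x y
    using that keys_diff[of x y] by (auto simp: free_tensor_carrier)
  have of: "frag_of (a, b) \<otimes>\<^bsub>?T\<^esub> y \<in> carrier ?T"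
    if y: "y \<in> carrier ?T" and "a \<in> carrier A" "b \<in> carrier B" for a b y
    using y by (induction rule: free_tensor_induct)
      (use that in \<open>simp_all add: lin diff\<close>, simp_all add: free_tensor_carrier)
  have closed: "x \<otimes>\<^bsub>?T\<^esub> y \<in> carrier ?T" if "x \<in> carrier ?T" "y \<in> carrier ?T" for x y
    using that(1) by (induction rule: free_tensor_induct)
      (use that in \<open>simp_all add: lin(1-6) diff of\<close>, simp add: free_tensor_carrier)
  have comm1: "frag_of (a, b) \<otimes>\<^bsub>?T\<^esub> y = y \<otimes>\<^bsub>?T\<^esub> frag_of (a, b)"
    if y: "y \<in> carrier ?T" and "a \<in> carrier A" "b \<in> carrier B" for a b y
    using y by (induction rule: free_tensor_induct)
      (use that in \<open>auto simp: lin A.m_comm B.m_comm\<close>)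
  have comm: "x \<otimes>\<^bsub>?T\<^esub> y = y \<otimes>\<^bsub>?T\<^esub> x" if "x \<in> carrier ?T" "y \<in> carrier ?T" for x y
    using that(1) by (induction rule: free_tensor_induct)
      (use that in \<open>auto simp: lin comm1\<close>)
  \<comment> \<open>Associativity is reached in three rounds: only \<open>z\<close> is a general
    formal sum in the first, \<open>y\<close> becomes general in the second and \<open>x\<close> in
    the third.\<close>
  have assoc1: "(frag_of (a, b) \<otimes>\<^bsub>?T\<^esub> frag_of (a', b')) \<otimes>\<^bsub>?T\<^esub> z
      = frag_of (a, b) \<otimes>\<^bsub>?T\<^esub> (frag_of (a', b') \<otimes>\<^bsub>?T\<^esub> z)"
    if z: "z \<in> carrier ?T" and "a \<in> carrier A" "b \<in> carrier B" "a' \<in> carrier A" "b' \<in> carrier B"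
    for a b a' b' z
    using z by (induction rule: free_tensor_induct)
      (use that in \<open>auto simp: lin A.m_assoc B.m_assoc\<close>)
  have assoc2: "(frag_of (a, b) \<otimes>\<^bsub>?T\<^esub> y) \<otimes>\<^bsub>?T\<^esub> z = frag_of (a, b) \<otimes>\<^bsub>?T\<^esub> (y \<otimes>\<^bsub>?T\<^esub> z)"
    if y: "y \<in> carrier ?T" and "z \<in> carrier ?T" "a \<in> carrier A" "b \<in> carrier B" for a b y z
    using y by (induction rule: free_tensor_induct)
      (use that in \<open>auto simp: lin(1-6) assoc1\<close>)
  have assoc: "(x \<otimes>\<^bsub>?T\<^esub> y) \<otimes>\<^bsub>?T\<^esub> z = x \<otimes>\<^bsub>?T\<^esub> (y \<otimes>\<^bsub>?T\<^esub> z)"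
    if "x \<in> carrier ?T" "y \<in> carrier ?T" "z \<in> carrier ?T" for x y z
    using that(1) by (induction rule: free_tensor_induct)
      (use that in \<open>auto simp: lin(1-6) assoc2\<close>)
  have one: "\<one>\<^bsub>?T\<^esub> \<otimes>\<^bsub>?T\<^esub> x = x" if "x \<in> carrier ?T" for x
    using that by (induction rule: free_tensor_induct) (auto simp: lin free_tensor_simps)
  have "comm_monoid ?T"
  proof (rule comm_monoidI)
    show "\<one>\<^bsub>?T\<^esub> \<in> carrier ?T" by (simp add: free_tensor_simps free_tensor_carrier)
  qed (simp_all add: closed one assoc, rule comm)
  then show ?thesis
    by (intro cringI abelian_group_free_tensor)
      (auto simp: lin free_tensor_simps)
qed

section \<open>The skew matrix algebra and its diagonal\<close>

locale reduced_skew = field F for F (structure) +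
  fixes n :: nat and c :: "nat \<Rightarrow> nat \<Rightarrow> nat \<Rightarrow> 'a"
  assumes n_pos: "n \<ge> 1" and reduced: "reduced_skew_set F n c"
begin

text \<open>A constant instead of the bare interval, so that membership in the index set stays
  folded under simplification.\<close>

definition idx :: "nat set" where "idx = {1..n}"

abbreviation A where "A \<equiv> skew_matrix_algebra F n c"
abbreviation Q where "Q \<equiv> function_algebra F (idx \<times> idx)"
abbreviation D where "D \<equiv> diagonal_subalgebra F n c"
abbreviation K where "K \<equiv> A\<lparr>carrier := D\<rparr>"
abbreviation E where "E i j \<equiv> delta_function F (idx \<times> idx) (i, j)"

sublocale Q: algebra F Q by (rule algebra_function_algebra)

lemma finite_idx [simp]: "finite idx" and one_idx: "1 \<in> idx"
  using n_pos by (auto simp: idx_def)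

lemma c_closed [simp]: "i \<in> idx \<Longrightarrow> j \<in> idx \<Longrightarrow> k \<in> idx \<Longrightarrow> c i j k \<in> carrier F"
  and c_reduced [simp]: "i \<in> idx \<Longrightarrow> j \<in> idx \<Longrightarrow> c i i j = \<one>" "i \<in> idx \<Longrightarrow> j \<in> idx \<Longrightarrow> c i j j = \<one>"
  using reduced by (simp_all add: reduced_skew_set_def skew_set_def idx_def del: One_nat_def)

text \<open>The skew algebra and \<open>Q\<close> differ only in product and unit. All linear facts
  are therefore taken from \<open>Q\<close>, which is a commutative associative algebra.\<close>

lemma A_carrier: "carrier A = carrier Q"
  and A_zero: "\<zero>\<^bsub>A\<^esub> = \<zero>\<^bsub>Q\<^esub>"
  and A_add: "add A = add Q"
  and A_smult: "smult A = smult Q"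
  by (simp_all add: skew_matrix_algebra_def function_algebra_def idx_def)

lemma A_add_monoid: "add_monoid A = add_monoid Q"
  by (simp add: A_carrier A_zero A_add)

lemmas A_Q = A_carrier A_zero A_add A_smult

lemma A_finsum: "finsum A f S = finsum Q f S"
  by (simp only: finsum_def A_add_monoid)

lemma A_minus: "x \<ominus>\<^bsub>A\<^esub> y = x \<ominus>\<^bsub>Q\<^esub> y"
  by (simp only: a_minus_def a_inv_def A_add_monoid) (simp only: A_add)

lemma A_one_entry: "i \<in> idx \<Longrightarrow> j \<in> idx \<Longrightarrow> \<one>\<^bsub>A\<^esub> (i, j) = (if i = j then \<one> else \<zero>)"
  by (simp add: skew_matrix_algebra_def idx_def)

lemma A_mult_entry:
  "i \<in> idx \<Longrightarrow> l \<in> idx \<Longrightarrow>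
    (x \<otimes>\<^bsub>A\<^esub> y) (i, l) = (\<Oplus>j\<in>idx. c i j l \<otimes> (x (i, j) \<otimes> y (j, l)))"
  by (simp add: skew_matrix_algebra_def idx_def)

lemma entry_closed [simp]: "x \<in> carrier Q \<Longrightarrow> i \<in> idx \<Longrightarrow> j \<in> idx \<Longrightarrow> x (i, j) \<in> carrier F"
  by (auto simp: function_algebra_carrier)

lemma Q_eqI:
  assumes "x \<in> carrier Q" "y \<in> carrier Q" "\<And>i j. i \<in> idx \<Longrightarrow> j \<in> idx \<Longrightarrow> x (i, j) = y (i, j)"
  shows "x = y"
  using assms by (intro function_algebra_eqI[of x F "idx \<times> idx" y]) auto

lemma Q_memI:
  assumes "\<And>i j. i \<in> idx \<Longrightarrow> j \<in> idx \<Longrightarrow> x (i, j) \<in> carrier F" "x \<in> extensional (idx \<times> idx)"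
  shows "x \<in> carrier Q"
  using assms by (auto simp: function_algebra_carrier PiE_iff)

lemma A_one_closed [simp]: "\<one>\<^bsub>A\<^esub> \<in> carrier Q"
  by (rule Q_memI) (auto simp: A_one_entry, simp add: skew_matrix_algebra_def idx_def)

lemma A_mult_closed [simp]:
  assumes "x \<in> carrier Q" "y \<in> carrier Q"
  shows "x \<otimes>\<^bsub>A\<^esub> y \<in> carrier Q"
proof (rule Q_memI)
  show "(x \<otimes>\<^bsub>A\<^esub> y) (i, l) \<in> carrier F" if "i \<in> idx" "l \<in> idx" for i l
    using that assms by (auto simp: A_mult_entry intro!: finsum_closed)
  show "x \<otimes>\<^bsub>A\<^esub> y \<in> extensional (idx \<times> idx)" by (simp add: skew_matrix_algebra_def idx_def)
qed

lemma E_closed [simp]: "E i j \<in> carrier Q"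
  by (rule delta_function_closed)

lemma E_entry: "k \<in> idx \<Longrightarrow> l \<in> idx \<Longrightarrow> E i j (k, l) = (if k = i \<and> l = j then \<one> else \<zero>)"
  by (simp add: delta_function_def)

lemma matrix_unit_E: "matrix_unit F n i j = E i j"
  by (simp add: matrix_unit_def delta_function_def idx_def)

text \<open>Collapses the sum over the middle index of a matrix product when one factor is
  diagonal.\<close>

lemma finsum_idx_single:
  assumes "i \<in> idx" "f i \<in> carrier F" "\<And>j. j \<in> idx \<Longrightarrow> j \<noteq> i \<Longrightarrow> f j = \<zero>"
  shows "(\<Oplus>j\<in>idx. f j) = f i"
proof -
  have "(\<Oplus>j\<in>idx. f j) = (\<Oplus>j\<in>idx. if i = j then f j else \<zero>)"
    using assms by (intro add.finprod_cong') auto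
  also have "\<dots> = (\<Oplus>j\<in>idx. if i = j then f i else \<zero>)"
    using assms by (intro add.finprod_cong') auto
  also have "\<dots> = f i"
    using add.finprod_singleton[of i idx "\<lambda>_. f i"] assms by auto
  finally show ?thesis .
qed

section \<open>The diagonal, entry by entry\<close>

lemma diagonal_sum_entry:
  assumes "d \<in> idx \<rightarrow> carrier F" "i \<in> idx" "j \<in> idx"
  shows "(\<Oplus>\<^bsub>Q\<^esub>k\<in>idx. d k \<odot>\<^bsub>Q\<^esub> E k k) (i, j) = (if i = j then d i else \<zero>)"
proof -
  have "(\<Oplus>\<^bsub>Q\<^esub>k\<in>idx. d k \<odot>\<^bsub>Q\<^esub> E k k) (i, j) = (\<Oplus>k\<in>idx. (d k \<odot>\<^bsub>Q\<^esub> E k k) (i, j))"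
    using assms by (intro function_algebra_finsum) auto
  also have "\<dots> = (d i \<odot>\<^bsub>Q\<^esub> E i i) (i, j)"
    using assms by (intro finsum_idx_single) (auto simp: function_algebra_simps E_entry Pi_iff)
  also have "\<dots> = (if i = j then d i else \<zero>)"
    using assms by (auto simp: function_algebra_simps E_entry Pi_iff)
  finally show ?thesis .
qed

lemma diagonal_sum:
  assumes "x \<in> carrier Q" "\<And>i j. i \<in> idx \<Longrightarrow> j \<in> idx \<Longrightarrow> i \<noteq> j \<Longrightarrow> x (i, j) = \<zero>"
  shows "x = (\<Oplus>\<^bsub>Q\<^esub>k\<in>idx. x (k, k) \<odot>\<^bsub>Q\<^esub> E k k)"
proof (rule Q_eqI)
  show "(\<Oplus>\<^bsub>Q\<^esub>k\<in>idx. x (k, k) \<odot>\<^bsub>Q\<^esub> E k k) \<in> carrier Q"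
    using assms by (intro Q.M.finsum_closed) auto
  show "x (i, j) = (\<Oplus>\<^bsub>Q\<^esub>k\<in>idx. x (k, k) \<odot>\<^bsub>Q\<^esub> E k k) (i, j)" if "i \<in> idx" "j \<in> idx" for i j
    using assms that by (subst diagonal_sum_entry) auto
qed fact

text \<open>The coefficient \<open>d i\<close> is the \<open>(i, i)\<close> entry of the sum, so the
  span of the diagonal units becomes a condition on entries, against which closure properties of
  \<open>D\<close> can be checked.\<close>

lemma D_iff: "x \<in> D \<longleftrightarrow> x \<in> carrier Q \<and> (\<forall>i\<in>idx. \<forall>j\<in>idx. i \<noteq> j \<longrightarrow> x (i, j) = \<zero>)"
proof -
  have D: "D = {\<Oplus>\<^bsub>Q\<^esub>k\<in>idx. d k \<odot>\<^bsub>Q\<^esub> E k k | d. d \<in> idx \<rightarrow> carrier F}"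
    by (simp add: diagonal_subalgebra_def A_finsum A_smult matrix_unit_E idx_def del: One_nat_def)
  show ?thesis
  proof
    assume "x \<in> D"
    then obtain d where "d \<in> idx \<rightarrow> carrier F" "x = (\<Oplus>\<^bsub>Q\<^esub>k\<in>idx. d k \<odot>\<^bsub>Q\<^esub> E k k)"
      by (auto simp: D)
    then show "x \<in> carrier Q \<and> (\<forall>i\<in>idx. \<forall>j\<in>idx. i \<noteq> j \<longrightarrow> x (i, j) = \<zero>)"
      by (auto simp: diagonal_sum_entry intro!: Q.M.finsum_closed)
  next
    assume x: "x \<in> carrier Q \<and> (\<forall>i\<in>idx. \<forall>j\<in>idx. i \<noteq> j \<longrightarrow> x (i, j) = \<zero>)"
    then show "x \<in> D"
      using diagonal_sum[of x] unfolding D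
      by (intro CollectI exI[of _ "\<lambda>k. x (k, k)"]) auto
  qed
qed

lemma D_closed [simp]: "x \<in> D \<Longrightarrow> x \<in> carrier Q"
  and D_off_diagonal: "x \<in> D \<Longrightarrow> i \<in> idx \<Longrightarrow> j \<in> idx \<Longrightarrow> i \<noteq> j \<Longrightarrow> x (i, j) = \<zero>"
  by (auto simp: D_iff)

text \<open>Only the summand \<open>j = i\<close> survives, and its structure constant is
  \<open>c i i l = 1\<close>; for a diagonal factor on the right the constant is
  \<open>c i l l = 1\<close>. Here reducedness enters.\<close>

lemma D_mult_left:
  assumes "d \<in> D" "x \<in> carrier Q" "i \<in> idx" "l \<in> idx"
  shows "(d \<otimes>\<^bsub>A\<^esub> x) (i, l) = d (i, i) \<otimes> x (i, l)"
proof -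
  have "(d \<otimes>\<^bsub>A\<^esub> x) (i, l) = c i i l \<otimes> (d (i, i) \<otimes> x (i, l))"
    unfolding A_mult_entry[OF assms(3,4)]
    by (rule finsum_idx_single) (use assms in \<open>auto simp: D_off_diagonal[of d i]\<close>)
  then show ?thesis using assms by simp
qed

lemma D_mult_right:
  assumes "d \<in> D" "x \<in> carrier Q" "i \<in> idx" "l \<in> idx"
  shows "(x \<otimes>\<^bsub>A\<^esub> d) (i, l) = x (i, l) \<otimes> d (l, l)"
proof -
  have "(x \<otimes>\<^bsub>A\<^esub> d) (i, l) = c i l l \<otimes> (x (i, l) \<otimes> d (l, l))"
    unfolding A_mult_entry[OF assms(3,4)]
    by (rule finsum_idx_single) (use assms in \<open>auto simp: D_off_diagonal[of d _ l]\<close>)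
  then show ?thesis using assms by simp
qed

lemma E_diagonal [simp]: "E i i \<in> D"
  by (auto simp: D_iff E_entry)

lemma D_one [simp]: "\<one>\<^bsub>A\<^esub> \<in> D"
  by (auto simp: D_iff A_one_entry)

lemma D_zero [simp]: "\<zero>\<^bsub>Q\<^esub> \<in> D"
  by (auto simp: D_iff function_algebra_simps)

lemma D_add [simp]: "x \<in> D \<Longrightarrow> y \<in> D \<Longrightarrow> x \<oplus>\<^bsub>Q\<^esub> y \<in> D"
  by (auto simp: D_iff function_algebra_simps)

lemma D_smult [simp]: "a \<in> carrier F \<Longrightarrow> x \<in> D \<Longrightarrow> a \<odot>\<^bsub>Q\<^esub> x \<in> D"
  by (auto simp: D_iff function_algebra_simps)

lemma D_mult [simp]: "x \<in> D \<Longrightarrow> y \<in> D \<Longrightarrow> x \<otimes>\<^bsub>A\<^esub> y \<in> D"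
  by (subst D_iff) (auto simp: D_mult_left D_off_diagonal)

lemma D_eqI:
  assumes "x \<in> D" "y \<in> D" "\<And>i. i \<in> idx \<Longrightarrow> x (i, i) = y (i, i)"
  shows "x = y"
proof (rule Q_eqI)
  show "x (i, j) = y (i, j)" if "i \<in> idx" "j \<in> idx" for i j
    using that assms by (cases "i = j") (auto simp: D_off_diagonal)
qed (use assms in auto)

text \<open>A diagonal factor merely scales, and both bracketings carry the same constants
  \<open>c i j l\<close>. An outer factor leaves the sum over \<open>j\<close> as
  \<open>d (i, i)\<close> or \<open>d (l, l)\<close>; a middle one contributes
  \<open>d (j, j)\<close> to the summand \<open>j\<close> on both sides.\<close>

lemma D_assoc:
  assumes d: "d \<in> D" and x: "x \<in> carrier Q" "y \<in> carrier Q"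
  shows "(d \<otimes>\<^bsub>A\<^esub> x) \<otimes>\<^bsub>A\<^esub> y = d \<otimes>\<^bsub>A\<^esub> (x \<otimes>\<^bsub>A\<^esub> y)"
    and "(x \<otimes>\<^bsub>A\<^esub> d) \<otimes>\<^bsub>A\<^esub> y = x \<otimes>\<^bsub>A\<^esub> (d \<otimes>\<^bsub>A\<^esub> y)"
    and "(x \<otimes>\<^bsub>A\<^esub> y) \<otimes>\<^bsub>A\<^esub> d = x \<otimes>\<^bsub>A\<^esub> (y \<otimes>\<^bsub>A\<^esub> d)"
proof -
  note [simp] = d x D_mult_left[OF d] D_mult_right[OF d] A_mult_entry[of _ _ x y]
  have cl: "(\<lambda>j. c i j l \<otimes> (x (i, j) \<otimes> y (j, l))) \<in> idx \<rightarrow> carrier F"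
    if "i \<in> idx" "l \<in> idx" for i l
    using that by auto
  show "(d \<otimes>\<^bsub>A\<^esub> x) \<otimes>\<^bsub>A\<^esub> y = d \<otimes>\<^bsub>A\<^esub> (x \<otimes>\<^bsub>A\<^esub> y)"
    by (rule Q_eqI) (auto simp: A_mult_entry[of _ _ _ y] finsum_rdistr cl m_lcomm m_assoc
        intro!: add.finprod_cong')
  show "(x \<otimes>\<^bsub>A\<^esub> d) \<otimes>\<^bsub>A\<^esub> y = x \<otimes>\<^bsub>A\<^esub> (d \<otimes>\<^bsub>A\<^esub> y)"
    by (rule Q_eqI) (auto simp: A_mult_entry[of _ _ "x \<otimes>\<^bsub>A\<^esub> d" y] A_mult_entry[of _ _ x "d \<otimes>\<^bsub>A\<^esub> y"] m_assoc
        intro!: add.finprod_cong')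
  show "(x \<otimes>\<^bsub>A\<^esub> y) \<otimes>\<^bsub>A\<^esub> d = x \<otimes>\<^bsub>A\<^esub> (y \<otimes>\<^bsub>A\<^esub> d)"
    by (rule Q_eqI) (auto simp: A_mult_entry[of _ _ x] finsum_ldistr cl m_assoc
        intro!: add.finprod_cong')
qed


section \<open>Nucleus, algebra laws, center and dimension\<close>

lemma D_nucleus: "D \<subseteq> nucleus A"
proof -
  have "u \<ominus>\<^bsub>Q\<^esub> u = \<zero>\<^bsub>Q\<^esub>" if "u \<in> carrier Q" for u
    using that by (simp add: Q.M.minus_eq Q.M.r_neg)
  then show ?thesis
    by (auto simp: nucleus_def associator_def A_Q A_minus D_assoc)
qed

lemma D_comm: "x \<in> D \<Longrightarrow> y \<in> D \<Longrightarrow> x \<otimes>\<^bsub>A\<^esub> y = y \<otimes>\<^bsub>A\<^esub> x"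
  by (rule D_eqI) (auto simp: D_mult_left m_comm)

lemma A_abelian_group: "abelian_group A"
  using Q.M.a_comm_group
  by (simp add: abelian_group.intro abelian_group_axioms.intro abelian_monoid.intro comm_group_def
      A_add_monoid)

lemma A_algebra: "unital_nonassoc_algebra F A"
proof -
  have m: "module F A"
    by (rule moduleI[OF is_cring A_abelian_group])
      (auto simp: A_Q Q.smult_l_distr Q.smult_r_distr Q.smult_assoc1)
  have cl: "(\<lambda>j. c i j l \<otimes> (x (i, j) \<otimes> y (j, l))) \<in> idx \<rightarrow> carrier F"
    if "i \<in> idx" "l \<in> idx" "x \<in> carrier Q" "y \<in> carrier Q" for i l x y
    using that by auto
  have "unital_nonassoc_algebra_axioms F A"
  proof (rule unital_nonassoc_algebra_axioms.intro; unfold A_Q)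
    fix x y z assume [simp]: "x \<in> carrier Q" "y \<in> carrier Q" "z \<in> carrier Q"
    show "(x \<oplus>\<^bsub>Q\<^esub> y) \<otimes>\<^bsub>A\<^esub> z = x \<otimes>\<^bsub>A\<^esub> z \<oplus>\<^bsub>Q\<^esub> y \<otimes>\<^bsub>A\<^esub> z"
    proof (rule Q_eqI)
      fix i l assume il: "i \<in> idx" "l \<in> idx"
      show "((x \<oplus>\<^bsub>Q\<^esub> y) \<otimes>\<^bsub>A\<^esub> z) (i, l) = (x \<otimes>\<^bsub>A\<^esub> z \<oplus>\<^bsub>Q\<^esub> y \<otimes>\<^bsub>A\<^esub> z) (i, l)"
        using il finsum_addf[OF cl[OF il] cl[OF il], of x z y z]
        by (simp add: A_mult_entry function_algebra_simps l_distr r_distr cong: finsum_cong)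
    qed auto
    show "z \<otimes>\<^bsub>A\<^esub> (x \<oplus>\<^bsub>Q\<^esub> y) = z \<otimes>\<^bsub>A\<^esub> x \<oplus>\<^bsub>Q\<^esub> z \<otimes>\<^bsub>A\<^esub> y"
    proof (rule Q_eqI)
      fix i l assume il: "i \<in> idx" "l \<in> idx"
      show "(z \<otimes>\<^bsub>A\<^esub> (x \<oplus>\<^bsub>Q\<^esub> y)) (i, l) = (z \<otimes>\<^bsub>A\<^esub> x \<oplus>\<^bsub>Q\<^esub> z \<otimes>\<^bsub>A\<^esub> y) (i, l)"
        using il finsum_addf[OF cl[OF il] cl[OF il], of z x z y]
        by (simp add: A_mult_entry function_algebra_simps l_distr r_distr cong: finsum_cong)
    qed auto
  next
    fix a x y assume [simp]: "a \<in> carrier F" "x \<in> carrier Q" "y \<in> carrier Q"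
    show "(a \<odot>\<^bsub>Q\<^esub> x) \<otimes>\<^bsub>A\<^esub> y = a \<odot>\<^bsub>Q\<^esub> (x \<otimes>\<^bsub>A\<^esub> y)"
      by (rule Q_eqI) (auto simp: A_mult_entry function_algebra_simps finsum_rdistr cl m_ac
          intro!: add.finprod_cong')
    show "x \<otimes>\<^bsub>A\<^esub> (a \<odot>\<^bsub>Q\<^esub> y) = a \<odot>\<^bsub>Q\<^esub> (x \<otimes>\<^bsub>A\<^esub> y)"
      by (rule Q_eqI) (auto simp: A_mult_entry function_algebra_simps finsum_rdistr cl m_ac
          intro!: add.finprod_cong')
  next
    fix x assume [simp]: "x \<in> carrier Q"
    show "\<one>\<^bsub>A\<^esub> \<otimes>\<^bsub>A\<^esub> x = x"
      by (rule Q_eqI) (auto simp: D_mult_left A_one_entry)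
    show "x \<otimes>\<^bsub>A\<^esub> \<one>\<^bsub>A\<^esub> = x"
      by (rule Q_eqI) (auto simp: D_mult_right A_one_entry)
  qed auto
  with m show ?thesis
    by (intro unital_nonassoc_algebra.intro field_axioms)
qed


lemma alg_center_eq: "alg_center A = (\<lambda>a. a \<odot>\<^bsub>A\<^esub> \<one>\<^bsub>A\<^esub>) ` carrier F"
proof (rule subset_antisym; rule subsetI)
  fix x assume "x \<in> alg_center A"
  then have x: "x \<in> carrier Q" and comm: "\<And>a. a \<in> carrier Q \<Longrightarrow> x \<otimes>\<^bsub>A\<^esub> a = a \<otimes>\<^bsub>A\<^esub> x"
    by (auto simp: alg_center_def nucleus_def A_Q)
  \<comment> \<open>In the entry \<open>(i, j)\<close>, multiplication by \<open>E i i\<close> from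
    the left keeps \<open>x (i, j)\<close>, while from the right it kills it, since \<open>j\<close>
    differs from \<open>i\<close>.\<close>
  have "x (i, j) = \<zero>" if "i \<in> idx" "j \<in> idx" "i \<noteq> j" for i j
    using fun_cong[OF comm[of "E i i"], of "(i, j)"] x that
    by (simp add: D_mult_left D_mult_right E_entry)
  then have xD: "x \<in> D" using x by (auto simp: D_iff)
  \<comment> \<open>The \<open>(i, 1)\<close> entries of the two products of \<open>x\<close> with
    \<open>E i 1\<close> are \<open>x (i, i)\<close> and \<open>x (1, 1)\<close>. The index 1 exists
    because \<open>n \<ge> 1\<close>.\<close>
  have diag: "x (i, i) = x (1, 1)" if "i \<in> idx" for i
    using fun_cong[OF comm[of "E i 1"], of "(i, 1)"] xD that one_idx
    by (simp add: D_mult_left D_mult_right E_entry del: One_nat_def)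
  have "x = x (1, 1) \<odot>\<^bsub>Q\<^esub> \<one>\<^bsub>A\<^esub>"
  proof (rule D_eqI)
    fix i assume "i \<in> idx"
    then show "x (i, i) = (x (1, 1) \<odot>\<^bsub>Q\<^esub> \<one>\<^bsub>A\<^esub>) (i, i)"
      using diag[of i] x one_idx by (simp add: function_algebra_simps A_one_entry del: One_nat_def)
  qed (use xD one_idx in \<open>auto simp del: One_nat_def\<close>)
  then show "x \<in> (\<lambda>a. a \<odot>\<^bsub>A\<^esub> \<one>\<^bsub>A\<^esub>) ` carrier F"
    using x one_idx by (intro image_eqI[of _ _ "x (1, 1)"]) (auto simp: A_Q simp del: One_nat_def)
next
  fix x assume "x \<in> (\<lambda>a. a \<odot>\<^bsub>A\<^esub> \<one>\<^bsub>A\<^esub>) ` carrier F"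
  then obtain a where a: "a \<in> carrier F" "x = a \<odot>\<^bsub>Q\<^esub> \<one>\<^bsub>A\<^esub>" by (auto simp: A_Q)
  then have xD: "x \<in> D" by simp
  have "x \<otimes>\<^bsub>A\<^esub> y = y \<otimes>\<^bsub>A\<^esub> x" if "y \<in> carrier Q" for y
    by (rule Q_eqI)
      (use that xD a in \<open>auto simp: D_mult_left D_mult_right function_algebra_simps A_one_entry m_comm\<close>)
  then show "x \<in> alg_center A"
    using D_nucleus xD by (auto simp: alg_center_def A_Q)
qed

lemma A_central: "central_algebra F A"
proof -
  \<comment> \<open>The entry \<open>(1, 1)\<close> of a multiple of the unit returns the
    scalar.\<close>
  have "a = b" if "a \<in> carrier F" "b \<in> carrier F" "a \<odot>\<^bsub>Q\<^esub> \<one>\<^bsub>A\<^esub> = b \<odot>\<^bsub>Q\<^esub> \<one>\<^bsub>A\<^esub>" for a b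
    using fun_cong[OF that(3), of "(1, 1)"] that(1,2) one_idx
    by (simp add: function_algebra_simps A_one_entry del: One_nat_def)
  then show ?thesis
    by (auto simp: central_algebra_def A_algebra bij_betw_def alg_center_eq A_Q inj_on_def)
qed

lemma A_finite_dimensional: "finite_dimensional F A"
  using finite_dimensional_function_algebra[of "idx \<times> idx"]
  by (simp add: finite_dimensional_def A_Q A_finsum)

lemma K_algebra: "algebra F K"
proof -
  have "abelian_group K"
  proof (rule abelian_groupI)
    fix x assume "x \<in> carrier K"
    then have x: "x \<in> D" by simp
    \<comment> \<open>The negative is built as a scalar multiple, so that it stays in
      \<open>D\<close> by closure under scalars.\<close>
    have "(\<ominus> \<one>) \<odot>\<^bsub>Q\<^esub> x \<in> D"
      using x by (intro D_smult) auto
    moreover have "(\<ominus> \<one>) \<odot>\<^bsub>Q\<^esub> x \<oplus>\<^bsub>Q\<^esub> x = \<zero>\<^bsub>Q\<^esub>"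
      using x by (simp add: Q.smult_l_minus Q.M.l_neg)
    ultimately show "\<exists>y\<in>carrier K. y \<oplus>\<^bsub>K\<^esub> x = \<zero>\<^bsub>K\<^esub>" by (auto simp: A_Q)
  qed (simp_all add: A_Q Q.M.a_assoc, simp add: Q.M.a_comm)
  moreover have "comm_monoid K"
    by (rule comm_monoidI) (simp_all add: D_assoc unital_nonassoc_algebra.mult_one_l[OF A_algebra]
       A_Q, rule D_comm)
  ultimately have "cring K"
    by (rule cringI) (simp add: unital_nonassoc_algebra.mult_l_distr[OF A_algebra, unfolded A_Q] A_Q)
  then show ?thesis
    by (intro algebraI is_cring)
      (simp_all add: A_Q Q.smult_l_distr Q.smult_r_distr Q.smult_assoc1
        unital_nonassoc_algebra.smult_mult_l[OF A_algebra, unfolded A_Q])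
qed


section \<open>The diagonal is etale\<close>

lemma K_etale: "etale_algebra F K"
proof -
  \<comment> \<open>\<open>etale_algebra\<close> asks for factors whose elements have the same type
    as matrices, namely functions on pairs of numbers. \<open>F\<close> is therefore realized as the
    functions on one pair, and any pair \<open>s\<close> will do.\<close>
  define s where "s = (0::nat, 0::nat)"
  define L where "L = function_algebra F {s}"
  define P where "P = alg_prod {..<n} (\<lambda>_. L)"
  \<comment> \<open>\<open>h\<close> reads off the diagonal; \<open>Suc k\<close> matches factors
    numbered from 0 with matrix indices starting at 1.\<close>
  define h where "h x = (\<lambda>k\<in>{..<n}. \<lambda>_\<in>{s}. x (Suc k, Suc k))" for x :: "nat \<times> nat \<Rightarrow> 'a"
  interpret L: algebra F L unfolding L_def by (rule algebra_function_algebra)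
  have Suc_idx: "Suc k \<in> idx" if "k < n" for k using that by (simp add: idx_def)
  have L: "(x \<otimes>\<^bsub>L\<^esub> y) s = x s \<otimes> y s" "(x \<oplus>\<^bsub>L\<^esub> y) s = x s \<oplus> y s" "\<one>\<^bsub>L\<^esub> s = \<one>"
    "(a \<odot>\<^bsub>L\<^esub> x) s = a \<otimes> x s" for x y a
    by (simp_all add: L_def function_algebra_simps)
  have P: "(x \<otimes>\<^bsub>P\<^esub> y) k = x k \<otimes>\<^bsub>L\<^esub> y k" "(x \<oplus>\<^bsub>P\<^esub> y) k = x k \<oplus>\<^bsub>L\<^esub> y k" "\<one>\<^bsub>P\<^esub> k = \<one>\<^bsub>L\<^esub>"
    "(a \<odot>\<^bsub>P\<^esub> x) k = a \<odot>\<^bsub>L\<^esub> x k" if "k < n" for x y a k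
    using that by (simp_all add: P_def alg_prod_def)
  have P_memI: "z \<in> carrier P" if "\<And>k. k < n \<Longrightarrow> z k \<in> carrier L" "z \<in> extensional {..<n}" for z
    using that by (auto simp: P_def alg_prod_def PiE_iff)
  have P_ext: "x \<otimes>\<^bsub>P\<^esub> y \<in> extensional {..<n}" "x \<oplus>\<^bsub>P\<^esub> y \<in> extensional {..<n}"
    "\<one>\<^bsub>P\<^esub> \<in> extensional {..<n}" "a \<odot>\<^bsub>P\<^esub> x \<in> extensional {..<n}" for x y a
    by (simp_all add: P_def alg_prod_def)
  have P_mem: "z k \<in> carrier L" if "z \<in> carrier P" "k < n" for z k
    using that by (auto simp: P_def alg_prod_def)
  have P_eqI: "z = w" if "z \<in> carrier P" "w \<in> carrier P" "\<And>k. k < n \<Longrightarrow> z k s = w k s" for z w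
  proof
    fix k
    show "z k = w k"
    proof (cases "k < n")
      case True
      show ?thesis
        using that(3)[OF True]
        by (intro function_algebra_eqI[OF P_mem[OF that(1) True, unfolded L_def]
              P_mem[OF that(2) True, unfolded L_def]]) simp
    next
      case False
      then show ?thesis
        using that(1,2) by (simp add: P_def alg_prod_def PiE_iff extensional_def)
    qed
  qed
  have h: "h x k s = x (Suc k, Suc k)" if "k < n" for x k
    using that by (simp add: h_def)
  have h_closed: "h x \<in> carrier P" if "x \<in> D" for x
    using entry_closed[OF D_closed[OF that] Suc_idx Suc_idx]
    by (intro P_memI) (auto simp: h_def L_def function_algebra_carrier)
  have "h \<in> ring_hom K P"
  proof (rule ring_hom_memI)
    fix x y assume "x \<in> carrier K" "y \<in> carrier K"
    then have xy: "x \<in> D" "y \<in> D" by auto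
    show "h (x \<otimes>\<^bsub>K\<^esub> y) = h x \<otimes>\<^bsub>P\<^esub> h y"
      using xy P_mem[OF h_closed[OF xy(1)]] P_mem[OF h_closed[OF xy(2)]]
      by (intro P_eqI h_closed P_memI P_ext) (auto simp: P L h Suc_idx D_mult_left)
    show "h (x \<oplus>\<^bsub>K\<^esub> y) = h x \<oplus>\<^bsub>P\<^esub> h y"
      using xy P_mem[OF h_closed[OF xy(1)]] P_mem[OF h_closed[OF xy(2)]]
      by (intro P_eqI h_closed P_memI P_ext) (auto simp: A_Q P L h Suc_idx function_algebra_simps)
  next
    show "h \<one>\<^bsub>K\<^esub> = \<one>\<^bsub>P\<^esub>"
      by (intro P_eqI h_closed P_memI P_ext) (auto simp: P L h Suc_idx A_one_entry)
  qed (auto intro: h_closed)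
  moreover have "inj_on h D"
  proof (rule inj_onI)
    fix x y assume xy: "x \<in> D" "y \<in> D" "h x = h y"
    show "x = y"
    proof (rule D_eqI)
      fix i assume "i \<in> idx"
      then have "i - 1 < n" "Suc (i - 1) = i" by (auto simp: idx_def)
      then show "x (i, i) = y (i, i)"
        using h[of "i - 1" x] h[of "i - 1" y] xy(3) by simp
    qed (use xy in auto)
  qed
  moreover have "z \<in> h ` D" if z: "z \<in> carrier P" for z
  proof
    \<comment> \<open>The preimage puts the components back on the diagonal, with the index shift
      undone.\<close>
    let ?x = "\<lambda>(i, j)\<in>idx \<times> idx. if i = j then z (i - 1) s else \<zero>"
    have "z (i - 1) s \<in> carrier F" if "i \<in> idx" for i
    proof -
      have "i - 1 < n" using that by (auto simp: idx_def)
      from P_mem[OF z this] show ?thesis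
        by (auto simp: L_def function_algebra_carrier)
    qed
    then show x: "?x \<in> D"
      by (auto simp: D_iff function_algebra_carrier simp del: One_nat_def)
    show "z = h ?x"
      using z x by (intro P_eqI h_closed) (auto simp: h Suc_idx)
  qed
  moreover have "h (a \<odot>\<^bsub>A\<^esub> x) = a \<odot>\<^bsub>P\<^esub> h x" if "a \<in> carrier F" "x \<in> D" for a x
    using that P_mem[OF h_closed[OF that(2)]]
    by (intro P_eqI h_closed P_memI P_ext) (auto simp: A_Q P L h Suc_idx function_algebra_simps)
  ultimately have "h \<in> alg_iso F K P"
    using h_closed by (auto simp: alg_iso_def ring_iso_def bij_betw_def)
  then have "alg_iso F K (alg_prod {..<n} (\<lambda>_. L)) \<noteq> {}"
    unfolding P_def by (metis empty_iff)
  moreover have "finite_separable_extension F L"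
    unfolding L_def by (rule finite_separable_function_algebra_singleton)
  ultimately show ?thesis
    unfolding etale_algebra_def
    by (intro conjI K_algebra exI[of _ n] exI[of _ "\<lambda>_. L"]) simp_all
qed


section \<open>The tensor square of the diagonal\<close>

abbreviation T where "T \<equiv> free_tensor K K"

text \<open>The outer product of the two diagonals, which is to be the image of a pure
  tensor.\<close>

definition tensor_entries where
  "tensor_entries p = (\<lambda>(i, j)\<in>idx \<times> idx. fst p (i, i) \<otimes> snd p (j, j))"

text \<open>The additive extension to formal sums. Its kernel turns out to be exactly the span of
  the tensor relations, so that it induces an embedding of \<open>K \<otimes> K\<close> into
  \<open>Q\<close>.\<close>

definition entry_map where "entry_map = frag_eval Q tensor_entries"

text \<open>A section of \<^term>\<open>entry_map\<close>, additive only modulo the tensor relations.\<close>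

definition entry_lift where
  "entry_lift s = (\<Sum>i\<in>idx. \<Sum>j\<in>idx. frag_of (s (i, j) \<odot>\<^bsub>Q\<^esub> E i i, E j j))"

definition relation_span where "relation_span = generate (add_monoid T) (tensor_relations F K K)"

lemma Q_cring: "cring Q" by (rule Q.M_cring)

lemma T_cring: "cring T"
  using K_algebra by (intro cring_free_tensor algebra.M_cring)

lemma T_carrier: "t \<in> carrier T \<longleftrightarrow> Poly_Mapping.keys t \<subseteq> D \<times> D"
  by (simp add: free_tensor_carrier)

lemma tensor_entries_closed: "tensor_entries \<in> D \<times> D \<rightarrow> carrier Q"
  by (auto simp: tensor_entries_def intro!: Q_memI)

lemma tensor_entries_entry:
  "i \<in> idx \<Longrightarrow> j \<in> idx \<Longrightarrow> tensor_entries (a, b) (i, j) = a (i, i) \<otimes> b (j, j)"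
  by (simp add: tensor_entries_def)

lemma entry_map_of: "a \<in> D \<Longrightarrow> b \<in> D \<Longrightarrow> entry_map (frag_of (a, b)) = tensor_entries (a, b)"
  using tensor_entries_closed by (auto simp: entry_map_def intro!: Q.M.frag_eval_of)

lemma entry_map_zero: "entry_map 0 = \<zero>\<^bsub>Q\<^esub>"
  by (simp add: entry_map_def)

lemma entry_map_closed: "t \<in> carrier T \<Longrightarrow> entry_map t \<in> carrier Q"
  using tensor_entries_closed by (auto simp: entry_map_def T_carrier)

lemma entry_map_add: "t \<in> carrier T \<Longrightarrow> u \<in> carrier T \<Longrightarrow> entry_map (t + u) = entry_map t \<oplus>\<^bsub>Q\<^esub> entry_map u"
  using Q.M.frag_eval_add[OF tensor_entries_closed] by (simp add: entry_map_def T_carrier)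

lemma entry_map_diff: "t \<in> carrier T \<Longrightarrow> u \<in> carrier T \<Longrightarrow> entry_map (t - u) = entry_map t \<ominus>\<^bsub>Q\<^esub> entry_map u"
  using Q.M.frag_eval_diff[OF tensor_entries_closed] by (simp add: entry_map_def T_carrier)

lemma of_in_T: "a \<in> D \<Longrightarrow> b \<in> D \<Longrightarrow> frag_of (a, b) \<in> carrier T"
  by (simp add: T_carrier)

lemma diff_in_T: "x \<in> carrier T \<Longrightarrow> y \<in> carrier T \<Longrightarrow> x - y \<in> carrier T"
  using keys_diff[of x y] by (auto simp: T_carrier)

text \<open>For pairs both sides have the entries \<open>a_i a'_i b_j b'_j\<close>, since diagonal
  matrices multiply entrywise. Both sides are additive in each factor, and two inductions extend
  this to formal sums.\<close>

lemma entry_map_mult: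
  assumes "x \<in> carrier T" "y \<in> carrier T"
  shows "entry_map (x \<otimes>\<^bsub>T\<^esub> y) = entry_map x \<otimes>\<^bsub>Q\<^esub> entry_map y"
proof -
  interpret TR: cring T by (rule T_cring)
  have of: "entry_map (frag_of (a, b) \<otimes>\<^bsub>T\<^esub> y) = entry_map (frag_of (a, b)) \<otimes>\<^bsub>Q\<^esub> entry_map y"
    if "a \<in> D" "b \<in> D" for a b
    using assms(2)
  proof (induction rule: free_tensor_induct)
    case (of a' b')
    then show ?case using that
      by (intro Q_eqI) (auto simp: free_tensor_mult_of entry_map_of function_algebra_simps
          tensor_entries_entry D_mult_left m_ac
          intro!: Q.m_closed funcset_mem[OF tensor_entries_closed])
  next
    case (diff y z)
    then show ?case using that
      by (simp add: free_tensor_mult_linear entry_map_diff entry_map_closed of_in_T Q.M.minus_eq Q.r_distr Q.r_minus)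
  qed (use that in \<open>simp add: free_tensor_mult_linear entry_map_zero entry_map_closed of_in_T\<close>)
  show ?thesis using assms(1)
  proof (induction rule: free_tensor_induct)
    case (diff x z)
    then show ?case using assms
      by (simp add: free_tensor_mult_linear entry_map_diff entry_map_closed Q.M.minus_eq Q.l_distr Q.l_minus)
  qed (use assms in \<open>simp_all add: of free_tensor_mult_linear entry_map_zero entry_map_closed\<close>)
qed

lemma entry_map_one: "entry_map \<one>\<^bsub>T\<^esub> = \<one>\<^bsub>Q\<^esub>"
proof -
  show ?thesis
    using funcset_mem[OF tensor_entries_closed, of "(\<one>\<^bsub>A\<^esub>, \<one>\<^bsub>A\<^esub>)"]
    by (intro Q_eqI) (auto simp: free_tensor_simps entry_map_of tensor_entries_entry A_one_entry function_algebra_simps)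
qed

lemma entry_map_ring_hom: "ring_hom_ring T Q entry_map"
  using T_cring Q_cring
  by (intro ring_hom_ringI2 ring_hom_memI)
    (simp_all add: cring_def entry_map_closed entry_map_mult entry_map_one, simp add: free_tensor_simps entry_map_add)

text \<open>The three families express additivity on the left, additivity on the right and the
  passage of a scalar across the tensor; the entries \<open>a_i b_j\<close> respect all
  three.\<close>

lemma relations_subset: "tensor_relations F K K \<subseteq> a_kernel T Q entry_map"
proof -
  have cancel: "t - u - v \<in> a_kernel T Q entry_map"
    if "t \<in> carrier T" "u \<in> carrier T" "v \<in> carrier T" "entry_map t = entry_map u \<oplus>\<^bsub>Q\<^esub> entry_map v" for t u v
  proof -
    have "entry_map v \<oplus>\<^bsub>Q\<^esub> entry_map u \<ominus>\<^bsub>Q\<^esub> entry_map u = entry_map v"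
      using that by (simp add: entry_map_closed Q.M.minus_eq Q.M.a_assoc Q.M.r_neg)
    then show ?thesis
      using that Q.M.a_comm[of "entry_map u" "entry_map v"]
      by (simp add: a_kernel_def' diff_in_T entry_map_diff entry_map_closed Q.M.minus_eq Q.M.r_neg)
  qed
  have cancel2: "t - u \<in> a_kernel T Q entry_map"
    if "t \<in> carrier T" "u \<in> carrier T" "entry_map t = entry_map u" for t u
    using that by (simp add: a_kernel_def' diff_in_T entry_map_diff entry_map_closed Q.M.minus_eq Q.M.r_neg)
  note te = funcset_mem[OF tensor_entries_closed]
  have te1: "tensor_entries (a \<oplus>\<^bsub>Q\<^esub> a', b) = tensor_entries (a, b) \<oplus>\<^bsub>Q\<^esub> tensor_entries (a', b)"
    if "a \<in> D" "a' \<in> D" "b \<in> D" for a a' b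
    using that by (intro Q_eqI) (auto simp: tensor_entries_entry function_algebra_simps l_distr
        intro!: te Q.M.a_closed)
  have te2: "tensor_entries (b, a \<oplus>\<^bsub>Q\<^esub> a') = tensor_entries (b, a) \<oplus>\<^bsub>Q\<^esub> tensor_entries (b, a')"
    if "a \<in> D" "a' \<in> D" "b \<in> D" for a a' b
    using that by (intro Q_eqI) (auto simp: tensor_entries_entry function_algebra_simps r_distr
        intro!: te Q.M.a_closed)
  have te3: "tensor_entries (r \<odot>\<^bsub>Q\<^esub> a, b) = tensor_entries (a, r \<odot>\<^bsub>Q\<^esub> b)"
    if "a \<in> D" "b \<in> D" "r \<in> carrier F" for a b r
    using that by (intro Q_eqI) (auto simp: tensor_entries_entry function_algebra_simps m_ac
        intro!: te)
  show ?thesis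
    unfolding tensor_relations_def
    by (intro Un_least; clarsimp simp: A_Q; (rule cancel | rule cancel2);
        simp add: entry_map_of of_in_T te1 te2 te3)
qed

section \<open>The relations span the kernel of the entry map\<close>

lemma relation_span_subset: "relation_span \<subseteq> a_kernel T Q entry_map"
proof -
  interpret entry_map: ring_hom_ring T Q entry_map by (rule entry_map_ring_hom)
  interpret ideal "a_kernel T Q entry_map" T by (rule entry_map.kernel_is_ideal)
  show ?thesis
    using entry_map.R.add.generate_subgroup_incl[OF relations_subset a_subgroup] by (simp only: relation_span_def)
qed

text \<open>The laws of the generated subgroup, restated with the subtraction of formal sums, so
  that congruences modulo the relations can be handled by ordinary simplification of differences and
  finite sums.\<close>

lemma relation_span_diff: "x \<in> relation_span \<Longrightarrow> y \<in> relation_span \<Longrightarrow> x - y \<in> relation_span"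
  and relation_span_zero: "0 \<in> relation_span"
proof -
  interpret TR: cring T by (rule T_cring)
  have rel: "tensor_relations F K K \<subseteq> carrier (add_monoid T)"
    using relations_subset by (auto simp: a_kernel_def')
  interpret relation_span: subgroup relation_span "add_monoid T"
    unfolding relation_span_def using rel by (intro TR.add.generate_is_subgroup) simp
  show "x - y \<in> relation_span" if xy: "x \<in> relation_span" "y \<in> relation_span"
  proof -
    have "x \<oplus>\<^bsub>T\<^esub> (\<ominus>\<^bsub>T\<^esub> y) \<in> relation_span"
      using relation_span.m_closed[OF xy(1) relation_span.m_inv_closed[OF xy(2)]] by (simp add: a_inv_def)
    moreover have "x \<in> carrier T" "y \<in> carrier T" using xy relation_span.subset by auto
    ultimately show ?thesis using free_tensor_minus[of x K K y] by (simp add: TR.minus_eq)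
  qed
  show "0 \<in> relation_span" using relation_span.one_closed by (simp add: free_tensor_simps)
qed

lemma relation_span_add: "x \<in> relation_span \<Longrightarrow> y \<in> relation_span \<Longrightarrow> x + y \<in> relation_span"
  using relation_span_diff[of x "0 - y"] relation_span_diff[OF relation_span_zero] by simp

lemma relation_span_uminus: "x \<in> relation_span \<Longrightarrow> - x \<in> relation_span"
  using relation_span_diff[OF relation_span_zero] by simp

lemma relation_span_sum: "(\<And>i. i \<in> S \<Longrightarrow> f i \<in> relation_span) \<Longrightarrow> sum f S \<in> relation_span"
  by (induction S rule: infinite_finite_induct) (auto simp: relation_span_zero relation_span_add)

lemma relation_in_span:
  shows "a \<in> D \<Longrightarrow> a' \<in> D \<Longrightarrow> b \<in> D \<Longrightarrow>
      frag_of (a \<oplus>\<^bsub>Q\<^esub> a', b) - frag_of (a, b) - frag_of (a', b) \<in> relation_span"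
    and "a \<in> D \<Longrightarrow> a' \<in> D \<Longrightarrow> b \<in> D \<Longrightarrow>
      frag_of (b, a \<oplus>\<^bsub>Q\<^esub> a') - frag_of (b, a) - frag_of (b, a') \<in> relation_span"
    and "r \<in> carrier F \<Longrightarrow> a \<in> D \<Longrightarrow> b \<in> D \<Longrightarrow>
      frag_of (r \<odot>\<^bsub>Q\<^esub> a, b) - frag_of (a, r \<odot>\<^bsub>Q\<^esub> b) \<in> relation_span"
  unfolding relation_span_def by (rule generate.incl, simp add: tensor_relations_def A_Q, blast)+

text \<open>For \<open>0 + 0 = 0\<close> the additive relation collapses to
  \<open>(0, b) - (0, b) - (0, b)\<close>, the negative of the generator.\<close>

lemma relation_span_of_zero:
  assumes "b \<in> D"
  shows "frag_of (\<zero>\<^bsub>Q\<^esub>, b) \<in> relation_span" and "frag_of (b, \<zero>\<^bsub>Q\<^esub>) \<in> relation_span"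
  using relation_span_uminus[OF relation_in_span(1)[of "\<zero>\<^bsub>Q\<^esub>" "\<zero>\<^bsub>Q\<^esub>" b]]
    relation_span_uminus[OF relation_in_span(2)[of "\<zero>\<^bsub>Q\<^esub>" "\<zero>\<^bsub>Q\<^esub>" b]] assms by simp_all

lemma D_finsum: "finite S \<Longrightarrow> f \<in> S \<rightarrow> D \<Longrightarrow> (\<Oplus>\<^bsub>Q\<^esub>k\<in>S. f k) \<in> D"
  by (induction S rule: finite_induct) (auto simp: Pi_iff)

lemma relation_span_of_finsum:
  assumes "finite S" "f \<in> S \<rightarrow> D" "b \<in> D"
  shows "frag_of (\<Oplus>\<^bsub>Q\<^esub>k\<in>S. f k, b) - (\<Sum>k\<in>S. frag_of (f k, b)) \<in> relation_span"
    and "frag_of (b, \<Oplus>\<^bsub>Q\<^esub>k\<in>S. f k) - (\<Sum>k\<in>S. frag_of (b, f k)) \<in> relation_span"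
proof -
  show "frag_of (\<Oplus>\<^bsub>Q\<^esub>k\<in>S. f k, b) - (\<Sum>k\<in>S. frag_of (f k, b)) \<in> relation_span"
    using assms(1,2)
  proof (induction S rule: finite_induct)
    case (insert k S)
    have "(frag_of (f k \<oplus>\<^bsub>Q\<^esub> (\<Oplus>\<^bsub>Q\<^esub>k\<in>S. f k), b) - frag_of (f k, b) - frag_of (\<Oplus>\<^bsub>Q\<^esub>k\<in>S. f k, b))
        + (frag_of (\<Oplus>\<^bsub>Q\<^esub>k\<in>S. f k, b) - (\<Sum>k\<in>S. frag_of (f k, b))) \<in> relation_span"
      using insert assms by (intro relation_span_add relation_in_span insert.IH D_finsum) auto
    moreover have "(\<Oplus>\<^bsub>Q\<^esub>k\<in>insert k S. f k) = f k \<oplus>\<^bsub>Q\<^esub> (\<Oplus>\<^bsub>Q\<^esub>k\<in>S. f k)"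
      using insert by (intro Q.M.finsum_insert) (auto simp: Pi_iff)
    ultimately show ?case using insert by (simp add: algebra_simps)
  qed (simp add: relation_span_of_zero assms)
  show "frag_of (b, \<Oplus>\<^bsub>Q\<^esub>k\<in>S. f k) - (\<Sum>k\<in>S. frag_of (b, f k)) \<in> relation_span"
    using assms(1,2)
  proof (induction S rule: finite_induct)
    case (insert k S)
    have "(frag_of (b, f k \<oplus>\<^bsub>Q\<^esub> (\<Oplus>\<^bsub>Q\<^esub>k\<in>S. f k)) - frag_of (b, f k) - frag_of (b, \<Oplus>\<^bsub>Q\<^esub>k\<in>S. f k))
        + (frag_of (b, \<Oplus>\<^bsub>Q\<^esub>k\<in>S. f k) - (\<Sum>k\<in>S. frag_of (b, f k))) \<in> relation_span"
      using insert assms by (intro relation_span_add relation_in_span insert.IH D_finsum) auto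
    moreover have "(\<Oplus>\<^bsub>Q\<^esub>k\<in>insert k S. f k) = f k \<oplus>\<^bsub>Q\<^esub> (\<Oplus>\<^bsub>Q\<^esub>k\<in>S. f k)"
      using insert by (intro Q.M.finsum_insert) (auto simp: Pi_iff)
    ultimately show ?case using insert by (simp add: algebra_simps)
  qed (simp add: relation_span_of_zero assms)
qed

text \<open>Expanding both diagonals turns \<open>a \<otimes> b\<close> into the sum of all
  \<open>a_i e_ii \<otimes> b_j e_jj\<close>. Moving \<open>b_j\<close> across the tensor collects
  the coefficient \<open>a_i b_j\<close> on the left, which is the normal form chosen by
  \<open>entry_lift\<close>.\<close>

lemma of_minus_entry_lift:
  assumes a: "a \<in> D" and b: "b \<in> D"
  shows "frag_of (a, b) - entry_lift (tensor_entries (a, b)) \<in> relation_span"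
proof -
  let ?a = "\<lambda>i. a (i, i) \<odot>\<^bsub>Q\<^esub> E i i" and ?b = "\<lambda>j. b (j, j) \<odot>\<^bsub>Q\<^esub> E j j"
  have eq: "a = (\<Oplus>\<^bsub>Q\<^esub>i\<in>idx. ?a i)" "b = (\<Oplus>\<^bsub>Q\<^esub>j\<in>idx. ?b j)"
    using a b by (auto intro!: diagonal_sum D_off_diagonal)
  have D: "?a \<in> idx \<rightarrow> D" "?b \<in> idx \<rightarrow> D" using a b by auto
  have 1: "frag_of (a, b) - (\<Sum>i\<in>idx. frag_of (?a i, b)) \<in> relation_span"
    using relation_span_of_finsum(1)[OF finite_idx D(1) b] eq(1) by simp
  have 2: "frag_of (?a i, b) - (\<Sum>j\<in>idx. frag_of (?a i, ?b j)) \<in> relation_span" if "i \<in> idx" for i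
    using relation_span_of_finsum(2)[OF finite_idx D(2), of "?a i"] D(1) eq(2) that by (simp add: Pi_iff)
  have 3: "frag_of (?a i, ?b j) - frag_of (tensor_entries (a, b) (i, j) \<odot>\<^bsub>Q\<^esub> E i i, E j j) \<in> relation_span"
    if ij: "i \<in> idx" "j \<in> idx" for i j
  proof -
    have "b (j, j) \<odot>\<^bsub>Q\<^esub> ?a i = tensor_entries (a, b) (i, j) \<odot>\<^bsub>Q\<^esub> E i i"
      using a b ij by (simp add: Q.smult_assoc1[symmetric] tensor_entries_entry m_comm)
    then show ?thesis
      using relation_span_uminus[OF relation_in_span(3)[of "b (j, j)" "?a i" "E j j"]] a b ij by simp
  qed
  \<comment> \<open>The difference telescopes through the expansion of \<open>a\<close>, then that
    of \<open>b\<close>, then the normal form, so that the three congruences apply in turn.\<close>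
  have "frag_of (a, b) - entry_lift (tensor_entries (a, b)) =
      (frag_of (a, b) - (\<Sum>i\<in>idx. frag_of (?a i, b)))
      + (\<Sum>i\<in>idx. (frag_of (?a i, b) - (\<Sum>j\<in>idx. frag_of (?a i, ?b j)))
        + (\<Sum>j\<in>idx. frag_of (?a i, ?b j) - frag_of (tensor_entries (a, b) (i, j) \<odot>\<^bsub>Q\<^esub> E i i, E j j)))"
    by (simp add: entry_lift_def sum_subtractf sum.distrib)
  also have "\<dots> \<in> relation_span"
    by (intro relation_span_add relation_span_sum 1 2 3)
  finally show ?thesis .
qed

text \<open>In each position \<open>(i, j)\<close> the difference is a single additive relation in
  the left factor, the right factor being \<open>E j j\<close> throughout.\<close>

lemma entry_lift_add:
  assumes "u \<in> carrier Q" "v \<in> carrier Q"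
  shows "entry_lift (u \<oplus>\<^bsub>Q\<^esub> v) - entry_lift u - entry_lift v \<in> relation_span"
proof -
  have "entry_lift (u \<oplus>\<^bsub>Q\<^esub> v) - entry_lift u - entry_lift v = (\<Sum>i\<in>idx. \<Sum>j\<in>idx.
      frag_of ((u \<oplus>\<^bsub>Q\<^esub> v) (i, j) \<odot>\<^bsub>Q\<^esub> E i i, E j j) - frag_of (u (i, j) \<odot>\<^bsub>Q\<^esub> E i i, E j j)
      - frag_of (v (i, j) \<odot>\<^bsub>Q\<^esub> E i i, E j j))"
    by (simp add: entry_lift_def sum_subtractf)
  also have "\<dots> \<in> relation_span"
    using assms by (intro relation_span_sum) (simp add: function_algebra_simps Q.smult_l_distr relation_in_span)
  finally show ?thesis .
qed

text \<open>Pairs are settled by the expansion into units. Since \<open>entry_lift\<close> is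
  additive modulo the relations, the property passes to differences.\<close>

lemma minus_entry_lift: "t \<in> carrier T \<Longrightarrow> t - entry_lift (entry_map t) \<in> relation_span"
proof (induction rule: free_tensor_induct)
  case zero
  have "entry_lift \<zero>\<^bsub>Q\<^esub> \<in> relation_span"
    unfolding entry_lift_def by (intro relation_span_sum) (simp add: function_algebra_simps relation_span_of_zero)
  then show ?case using relation_span_uminus by (simp add: entry_map_zero)
next
  case (of a b)
  then show ?case by (simp add: entry_map_of of_minus_entry_lift)
next
  case (diff x y)
  \<comment> \<open>The additivity of \<open>entry_lift\<close> concerns sums, whereas the induction
    yields a difference; hence it is applied to \<open>?d\<close> plus \<open>entry_map y\<close>,
    which is \<open>entry_map x\<close>.\<close>
  let ?d = "entry_map x \<ominus>\<^bsub>Q\<^esub> entry_map y"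
  have cl: "entry_map x \<in> carrier Q" "entry_map y \<in> carrier Q" "?d \<in> carrier Q"
    using diff entry_map_closed by auto
  then have "?d \<oplus>\<^bsub>Q\<^esub> entry_map y = entry_map x"
    by (simp add: Q.M.minus_eq Q.M.a_assoc Q.M.l_neg)
  then have "entry_lift (entry_map x) - entry_lift ?d - entry_lift (entry_map y) \<in> relation_span"
    using entry_lift_add[OF cl(3,2)] by simp
  then have "((x - entry_lift (entry_map x)) - (y - entry_lift (entry_map y)))
      + (entry_lift (entry_map x) - entry_lift ?d - entry_lift (entry_map y)) \<in> relation_span"
    using diff by (intro relation_span_add relation_span_diff[of "x - entry_lift (entry_map x)"])
  then show ?case using diff by (simp add: entry_map_diff algebra_simps)
qed

text \<open>A kernel element is congruent to the lift of zero, and so is 0 itself; subtracting the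
  two congruences puts the element into the span.\<close>

lemma relation_span_eq_kernel: "relation_span = a_kernel T Q entry_map"
proof (rule subset_antisym[OF relation_span_subset]; rule subsetI)
  fix t assume "t \<in> a_kernel T Q entry_map"
  then have t: "t \<in> carrier T" "entry_map t = \<zero>\<^bsub>Q\<^esub>" by (auto simp: a_kernel_def')
  have "0 - entry_lift \<zero>\<^bsub>Q\<^esub> \<in> relation_span"
    using minus_entry_lift[of 0] by (simp add: T_carrier entry_map_zero)
  then have "(t - entry_lift (entry_map t)) - (0 - entry_lift \<zero>\<^bsub>Q\<^esub>) \<in> relation_span"
    using minus_entry_lift[OF t(1)] by (intro relation_span_diff[of "t - entry_lift (entry_map t)"])
  then show "t \<in> relation_span" using t by simp
qed


section \<open>The bimodule action\<close>

abbreviation R where "R \<equiv> tensor_ring F K K"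
abbreviation B where "B \<equiv> bimodule A"
definition coset where "coset t = relation_span +>\<^bsub>T\<^esub> t"

lemma R_eq: "R = T Quot relation_span"
  by (simp add: tensor_ring_def relation_span_def)

lemma relation_span_ideal: "ideal relation_span T"
proof -
  interpret entry_map: ring_hom_ring T Q entry_map by (rule entry_map_ring_hom)
  show ?thesis unfolding relation_span_eq_kernel by (rule entry_map.kernel_is_ideal)
qed

lemma relation_span_iff: "t \<in> relation_span \<longleftrightarrow> t \<in> carrier T \<and> entry_map t = \<zero>\<^bsub>Q\<^esub>"
  by (simp only: relation_span_eq_kernel a_kernel_def' mem_Collect_eq)

lemma R_cring: "cring R"
  unfolding R_eq by (rule ideal.quotient_is_cring[OF relation_span_ideal T_cring])

lemma R_carrierE:
  assumes "r \<in> carrier R"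
  obtains t where "t \<in> carrier T" "r = coset t"
  using assms by (auto simp: R_eq FactRing_def A_RCOSETS_def' coset_def)

lemma coset_hom:
  assumes "t \<in> carrier T"
  shows "coset t \<in> carrier R"
    and "u \<in> carrier T \<Longrightarrow> coset t \<oplus>\<^bsub>R\<^esub> coset u = coset (t + u)"
    and "u \<in> carrier T \<Longrightarrow> coset t \<otimes>\<^bsub>R\<^esub> coset u = coset (t \<otimes>\<^bsub>T\<^esub> u)"
proof -
  interpret ring_hom_ring T R "(+>\<^bsub>T\<^esub>) relation_span"
    unfolding R_eq by (rule ideal.rcos_ring_hom_ring[OF relation_span_ideal])
  show "coset t \<in> carrier R"
    and "u \<in> carrier T \<Longrightarrow> coset t \<oplus>\<^bsub>R\<^esub> coset u = coset (t + u)"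
    and "u \<in> carrier T \<Longrightarrow> coset t \<otimes>\<^bsub>R\<^esub> coset u = coset (t \<otimes>\<^bsub>T\<^esub> u)"
    using assms hom_add[of t u] by (simp_all add: coset_def free_tensor_simps)
qed

lemma coset_one: "\<one>\<^bsub>R\<^esub> = coset \<one>\<^bsub>T\<^esub>"
  by (simp add: R_eq FactRing_def coset_def)

lemma coset_eq_zero_iff:
  assumes "t \<in> carrier T"
  shows "coset t = \<zero>\<^bsub>R\<^esub> \<longleftrightarrow> entry_map t = \<zero>\<^bsub>Q\<^esub>"
proof -
  interpret span: ideal relation_span T by (rule relation_span_ideal)
  have "coset t = relation_span" if "t \<in> relation_span"
    unfolding coset_def by (rule span.a_rcos_const[OF that])
  moreover have "t \<in> coset t"
    unfolding coset_def by (rule span.a_rcos_self[OF assms])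
  ultimately have "coset t = relation_span \<longleftrightarrow> t \<in> relation_span" by auto
  moreover have "\<zero>\<^bsub>R\<^esub> = relation_span" by (simp add: R_eq FactRing_def)
  moreover have "t \<in> relation_span \<longleftrightarrow> entry_map t = \<zero>\<^bsub>Q\<^esub>"
    using assms by (simp add: relation_span_iff)
  ultimately show ?thesis by (simp only:)
qed

text \<open>A pair \<open>(a, b)\<close> turns \<open>x\<close> into the matrix with entries
  \<open>a_i x_ij b_j\<close>, the entrywise product with \<open>(a_i b_j)\<close>. Both sides are
  additive in \<open>t\<close>.\<close>

lemma free_bimodule_action_eq:
  assumes t: "t \<in> carrier T" and x: "x \<in> carrier Q"
  shows "free_bimodule_action A t x = entry_map t \<otimes>\<^bsub>Q\<^esub> x"
proof -
  let ?f = "\<lambda>p. (fst p \<otimes>\<^bsub>A\<^esub> x) \<otimes>\<^bsub>A\<^esub> snd p"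
  have f: "?f \<in> D \<times> D \<rightarrow> carrier Q" using x by (simp add: Pi_iff mem_Times_iff)
  have "free_bimodule_action A t x = frag_eval Q ?f t"
    using frag_eval_cong_add_monoid[OF A_add_monoid]
    by (simp add: free_bimodule_action_def frag_eval_def)
  also have "\<dots> = entry_map t \<otimes>\<^bsub>Q\<^esub> x"
    using t
  proof (induction rule: free_tensor_induct)
    case zero
    then show ?case using x by (simp add: entry_map_zero)
  next
    case (of a b)
    then have "frag_eval Q ?f (frag_of (a, b)) = ?f (a, b)"
      using x by (intro Q.M.frag_eval_of) auto
    also have "\<dots> = entry_map (frag_of (a, b)) \<otimes>\<^bsub>Q\<^esub> x"
      using of x funcset_mem[OF tensor_entries_closed, of "(a, b)"]
      by (intro Q_eqI) (auto simp: entry_map_of D_mult_left D_mult_right tensor_entries_entry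
          function_algebra_simps m_ac)
    finally show ?case .
  next
    case (diff t u)
    then show ?case
      using x Q.M.frag_eval_diff[OF f, of t u] by (simp add: T_carrier entry_map_diff entry_map_closed Q.M.minus_eq
          Q.l_distr Q.l_minus)
  qed
  finally show ?thesis .
qed

lemma bimodule_simps:
  "carrier B = carrier Q" "\<zero>\<^bsub>B\<^esub> = \<zero>\<^bsub>Q\<^esub>" "add B = add Q"
  by (simp_all add: bimodule_def A_Q)

text \<open>The action of a coset is \<open>the_elem\<close> of the set of values at all its
  representatives. Representatives differ by elements that \<open>entry_map\<close> kills, so this
  set is a singleton and the action is well defined.\<close>

lemma bimodule_smult:
  assumes t: "t \<in> carrier T" and x: "x \<in> carrier Q"
  shows "coset t \<odot>\<^bsub>B\<^esub> x = entry_map t \<otimes>\<^bsub>Q\<^esub> x"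
proof -
  interpret span: ideal relation_span T by (rule relation_span_ideal)
  have "free_bimodule_action A u x = entry_map t \<otimes>\<^bsub>Q\<^esub> x" if u: "u \<in> coset t" for u
  proof -
    obtain h where h: "h \<in> relation_span" "u = h + t"
      using u by (auto simp: coset_def a_r_coset_def' free_tensor_simps)
    then have hT: "h \<in> carrier T" "entry_map h = \<zero>\<^bsub>Q\<^esub>"
      by (simp_all only: relation_span_iff)
    have "u \<in> carrier T"
      using span.a_closed[OF hT(1) t] h(2) by (simp only: free_tensor_simps)
    moreover have "entry_map u = entry_map t"
      using entry_map_add[OF hT(1) t] hT(2) entry_map_closed[OF t] h(2) by simp
    ultimately show ?thesis by (simp only: free_bimodule_action_eq x)
  qed
  moreover have "t \<in> coset t" using span.a_rcos_self[OF t] by (simp add: coset_def)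
  ultimately have "(\<lambda>u. free_bimodule_action A u x) ` coset t = {entry_map t \<otimes>\<^bsub>Q\<^esub> x}" by auto
  then show ?thesis by (simp add: bimodule_def)
qed

text \<open>With scalars written as cosets, the axioms on the action become ring laws of
  \<open>Q\<close>, because \<open>entry_map\<close> is a ring homomorphism and the action is the
  product of \<open>Q\<close>.\<close>

lemma B_module: "module R B"
proof (rule moduleI[OF R_cring])
  show "abelian_group B"
  proof (rule abelian_groupI)
    fix x assume "x \<in> carrier B"
    then show "\<exists>y\<in>carrier B. y \<oplus>\<^bsub>B\<^esub> x = \<zero>\<^bsub>B\<^esub>"
      by (intro bexI[of _ "\<ominus>\<^bsub>Q\<^esub> x"]) (simp_all add: bimodule_simps Q.M.l_neg)
  qed (simp_all add: bimodule_simps Q.M.a_assoc, simp add: Q.M.a_comm)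
next
  fix r x assume "r \<in> carrier R" "x \<in> carrier B"
  then show "r \<odot>\<^bsub>B\<^esub> x \<in> carrier B"
    by (elim R_carrierE) (simp add: bimodule_simps bimodule_smult entry_map_closed)
next
  fix r s x assume "r \<in> carrier R" "s \<in> carrier R" "x \<in> carrier B"
  then obtain t u where tu: "t \<in> carrier T" "r = coset t" "u \<in> carrier T" "s = coset u"
    and x: "x \<in> carrier Q" by (auto elim!: R_carrierE simp: bimodule_simps)
  have c: "t + u \<in> carrier T" "t \<otimes>\<^bsub>T\<^esub> u \<in> carrier T"
    using tu cring.cring_simprules(1,5)[OF T_cring, of t u] by (simp_all add: free_tensor_simps)
  show "(r \<oplus>\<^bsub>R\<^esub> s) \<odot>\<^bsub>B\<^esub> x = r \<odot>\<^bsub>B\<^esub> x \<oplus>\<^bsub>B\<^esub> s \<odot>\<^bsub>B\<^esub> x"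
    using tu x c by (simp add: coset_hom bimodule_smult bimodule_simps entry_map_add entry_map_closed Q.l_distr)
  show "(r \<otimes>\<^bsub>R\<^esub> s) \<odot>\<^bsub>B\<^esub> x = r \<odot>\<^bsub>B\<^esub> (s \<odot>\<^bsub>B\<^esub> x)"
    using tu x c by (simp add: coset_hom bimodule_smult bimodule_simps entry_map_mult entry_map_closed Q.m_assoc)
next
  fix r x y assume "r \<in> carrier R" "x \<in> carrier B" "y \<in> carrier B"
  then show "r \<odot>\<^bsub>B\<^esub> (x \<oplus>\<^bsub>B\<^esub> y) = r \<odot>\<^bsub>B\<^esub> x \<oplus>\<^bsub>B\<^esub> r \<odot>\<^bsub>B\<^esub> y"
    by (elim R_carrierE) (simp add: bimodule_simps bimodule_smult entry_map_closed Q.r_distr)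
next
  fix x assume "x \<in> carrier B"
  then show "\<one>\<^bsub>R\<^esub> \<odot>\<^bsub>B\<^esub> x = x"
    using cring.cring_simprules(6)[OF T_cring]
    by (simp add: coset_one bimodule_simps bimodule_smult entry_map_one)
qed

lemma B_faithful: "faithful_module R B"
  unfolding faithful_module_def
proof (intro ballI impI)
  fix r assume "r \<in> carrier R" and r: "\<forall>x\<in>carrier B. r \<odot>\<^bsub>B\<^esub> x = \<zero>\<^bsub>B\<^esub>"
  then obtain t where t: "t \<in> carrier T" "r = coset t" by (auto elim: R_carrierE)
  \<comment> \<open>The test vector is the unit of \<open>Q\<close>, the all-ones matrix, and not
    the unit of \<open>A\<close>: acting on it returns all entries of the scalar.\<close>
  have "entry_map t \<otimes>\<^bsub>Q\<^esub> \<one>\<^bsub>Q\<^esub> = \<zero>\<^bsub>Q\<^esub>"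
    using r t by (simp add: bimodule_simps bimodule_smult[symmetric])
  then show "r = \<zero>\<^bsub>R\<^esub>" using t by (simp add: coset_eq_zero_iff entry_map_closed)
qed

section \<open>Submodules and sections of the bimodule\<close>

lemma E_scalar:
  assumes "i \<in> idx" "j \<in> idx" "a \<in> carrier F"
  obtains t where "t \<in> carrier T" "entry_map t = a \<odot>\<^bsub>Q\<^esub> E i j"
proof
  \<comment> \<open>The outer product of the diagonals of \<open>a e_ii\<close> and
    \<open>e_jj\<close> is supported at the single position \<open>(i, j)\<close>.\<close>
  let ?t = "frag_of (a \<odot>\<^bsub>Q\<^esub> E i i, E j j)"
  show "?t \<in> carrier T" using assms by (simp add: of_in_T)
  show "entry_map ?t = a \<odot>\<^bsub>Q\<^esub> E i j"
    using assms funcset_mem[OF tensor_entries_closed, of "(a \<odot>\<^bsub>Q\<^esub> E i i, E j j)"]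
    by (intro Q_eqI) (auto simp: entry_map_of tensor_entries_entry function_algebra_simps E_entry)
qed

lemma E_mult:
  assumes "x \<in> carrier Q" "i \<in> idx" "j \<in> idx" "a \<in> carrier F"
  shows "(a \<odot>\<^bsub>Q\<^esub> E i j) \<otimes>\<^bsub>Q\<^esub> x = (a \<otimes> x (i, j)) \<odot>\<^bsub>Q\<^esub> E i j"
  using assms by (intro Q_eqI) (auto simp: function_algebra_simps E_entry)

lemma submodule_scale:
  assumes P: "submodule P R B" and x: "x \<in> P" and ij: "i \<in> idx" "j \<in> idx" and a: "a \<in> carrier F"
  shows "(a \<otimes> x (i, j)) \<odot>\<^bsub>Q\<^esub> E i j \<in> P"
proof -
  interpret P: submodule P R B by (rule P)
  obtain t where t: "t \<in> carrier T" "entry_map t = a \<odot>\<^bsub>Q\<^esub> E i j" using E_scalar[OF ij a] .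
  have xQ: "x \<in> carrier Q" using P.mem_carrier[OF x] by (simp add: bimodule_simps)
  have "coset t \<odot>\<^bsub>B\<^esub> x \<in> P" using t x by (simp add: coset_hom P.smult_closed)
  then show ?thesis using t xQ ij a by (simp add: bimodule_smult E_mult)
qed

text \<open>Once the position \<open>(i, j)\<close> is isolated, dividing by the nonzero entry
  produces any prescribed coefficient there.\<close>

lemma submodule_E:
  assumes P: "submodule P R B" and x: "x \<in> P" and ij: "i \<in> idx" "j \<in> idx"
    and nz: "x (i, j) \<noteq> \<zero>" and b: "b \<in> carrier F"
  shows "b \<odot>\<^bsub>Q\<^esub> E i j \<in> P"
proof -
  interpret P: submodule P R B by (rule P)
  have xQ: "x \<in> carrier Q" using P.mem_carrier[OF x] by (simp add: bimodule_simps)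
  then have u: "x (i, j) \<in> Units F" using ij nz by (simp add: field_Units)
  have "((b \<otimes> inv (x (i, j))) \<otimes> x (i, j)) \<odot>\<^bsub>Q\<^esub> E i j \<in> P"
    using P x ij b u by (intro submodule_scale) auto
  moreover have "(b \<otimes> inv (x (i, j))) \<otimes> x (i, j) = b"
    using b u by (simp add: m_assoc Units_closed)
  ultimately show ?thesis by (simp only:)
qed

lemma B_minimal:
  assumes P: "submodule P R B" and N: "submodule N R B" and NP: "N \<subseteq> P"
    and faithful: "faithful_module R (module_section B P N)"
  shows "P = carrier B" and "N = {\<zero>\<^bsub>B\<^esub>}"
proof -
  interpret P: submodule P R B by (rule P)
  interpret N: submodule N R B by (rule N)
  interpret B: abelian_group B using B_module by (rule module.axioms)
  have PQ: "x \<in> carrier Q" if "x \<in> P" for x using P.mem_carrier[OF that] by (simp add: bimodule_simps)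
  have NQ: "x \<in> carrier Q" if "x \<in> N" for x using N.mem_carrier[OF that] by (simp add: bimodule_simps)
  have coset_N: "N +>\<^bsub>B\<^esub> z = N" if "z \<in> N" for z
    using B.add.coset_join2[of z N] that N.subgroup_axioms N.mem_carrier[OF that]
    by (simp add: a_r_coset_def)
  have ex: "\<exists>x\<in>P. x (i, j) \<odot>\<^bsub>Q\<^esub> E i j \<notin> N" if ij: "i \<in> idx" "j \<in> idx" for i j
  proof (rule ccontr)
    assume "\<not> ?thesis"
    then have in_N: "x (i, j) \<odot>\<^bsub>Q\<^esub> E i j \<in> N" if "x \<in> P" for x using that by blast
    \<comment> \<open>\<open>t\<close> represents the idempotent \<open>e_ii \<otimes> e_jj\<close>,
      which by assumption maps \<open>P\<close> into \<open>N\<close>.\<close>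
    obtain t where t: "t \<in> carrier T" "entry_map t = \<one> \<odot>\<^bsub>Q\<^esub> E i j" using E_scalar[OF ij one_closed] .
    have t_N: "coset t \<odot>\<^bsub>B\<^esub> x \<in> N" if "x \<in> P" for x
      using t in_N[OF that] PQ[OF that] ij by (simp only: bimodule_smult E_mult one_closed) simp
    have "coset t \<odot>\<^bsub>module_section B P N\<^esub> C = \<zero>\<^bsub>module_section B P N\<^esub>"
      if C: "C \<in> carrier (module_section B P N)" for C
    proof -
      obtain y where y: "y \<in> P" "C = N +>\<^bsub>B\<^esub> y"
        using C by (auto simp: module_section_def A_RCOSETS_def RCOSETS_def a_r_coset_def r_coset_def)
      \<comment> \<open>The action on a section is a union over the representatives in
        \<open>C\<close>. They all lie in \<open>P\<close> because \<open>N \<subseteq> P\<close>,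
        so each contributes the coset \<open>N\<close>; the member \<open>y\<close> keeps the union
        from being empty.\<close>
      have "C \<subseteq> P" "y \<in> C"
        using y NP P.m_closed N.one_closed PQ[OF y(1)] by (auto simp: a_r_coset_def' bimodule_simps intro!: bexI[of _ "\<zero>\<^bsub>Q\<^esub>"])
      then have "(\<Union>x\<in>C. N +>\<^bsub>B\<^esub> (coset t \<odot>\<^bsub>B\<^esub> x)) = (\<Union>x\<in>C. N)"
        by (intro SUP_cong refl coset_N t_N) auto
      also have "\<dots> = N" using \<open>y \<in> C\<close> by auto
      finally show ?thesis by (simp add: module_section_def)
    qed
    then have "coset t = \<zero>\<^bsub>R\<^esub>"
      using faithful t coset_hom(1) unfolding faithful_module_def by blast
    \<comment> \<open>Faithfulness forces the idempotent to vanish, which its entry 1 at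
      \<open>(i, j)\<close> contradicts.\<close>
    then have "E i j = \<zero>\<^bsub>Q\<^esub>" using t by (simp add: coset_eq_zero_iff)
    then have "E i j (i, j) = \<zero>" using ij by (simp add: function_algebra_simps)
    then show False using ij by (simp add: E_entry)
  qed
  have E_P: "b \<odot>\<^bsub>Q\<^esub> E i j \<in> P" if ij: "i \<in> idx" "j \<in> idx" and b: "b \<in> carrier F" for i j b
  proof -
    obtain x where x: "x \<in> P" "x (i, j) \<odot>\<^bsub>Q\<^esub> E i j \<notin> N" using ex[OF ij] by blast
    \<comment> \<open>With a zero entry the multiple would be the zero matrix, which lies in
      \<open>N\<close>.\<close>
    then have "x (i, j) \<noteq> \<zero>" using N.one_closed by (auto simp: bimodule_simps)
    then show ?thesis using submodule_E[OF P x(1) ij _ b] by simp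
  qed
  have "x \<in> P" if x: "x \<in> carrier Q" for x
  proof -
    have x_entries: "x \<in> idx \<times> idx \<rightarrow> carrier F" using x by (auto simp: function_algebra_carrier)
    \<comment> \<open>The induction adds one position at a time, staying in \<open>P\<close>; over
      all positions the sum is \<open>x\<close>.\<close>
    have fin: "(\<Oplus>\<^bsub>Q\<^esub>s\<in>S. x s \<odot>\<^bsub>Q\<^esub> delta_function F (idx \<times> idx) s) \<in> P"
      if "finite S" "S \<subseteq> idx \<times> idx" for S
      using that
    proof (induction S rule: finite_induct)
      case empty
      then show ?case using P.one_closed by (simp add: bimodule_simps)
    next
      case (insert s S)
      then obtain i j where s: "s = (i, j)" "i \<in> idx" "j \<in> idx" by auto
      have "(\<lambda>s. x s \<odot>\<^bsub>Q\<^esub> delta_function F (idx \<times> idx) s) \<in> insert s S \<rightarrow> carrier Q"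
        using insert.prems x_entries by (blast intro: Q.smult_closed delta_function_closed)
      then have "(\<Oplus>\<^bsub>Q\<^esub>s\<in>insert s S. x s \<odot>\<^bsub>Q\<^esub> delta_function F (idx \<times> idx) s) =
          x s \<odot>\<^bsub>Q\<^esub> delta_function F (idx \<times> idx) s \<oplus>\<^bsub>Q\<^esub>
          (\<Oplus>\<^bsub>Q\<^esub>s\<in>S. x s \<odot>\<^bsub>Q\<^esub> delta_function F (idx \<times> idx) s)"
        using insert.hyps by (intro Q.M.finsum_insert) auto
      moreover have "x s \<odot>\<^bsub>Q\<^esub> delta_function F (idx \<times> idx) s \<in> P"
        unfolding s(1) using s x by (intro E_P) auto
      moreover have "u \<oplus>\<^bsub>Q\<^esub> v \<in> P" if "u \<in> P" "v \<in> P" for u v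
        using P.m_closed[OF that] by (simp add: bimodule_simps)
      moreover have "(\<Oplus>\<^bsub>Q\<^esub>s\<in>S. x s \<odot>\<^bsub>Q\<^esub> delta_function F (idx \<times> idx) s) \<in> P"
        using insert.prems by (intro insert.IH) auto
      ultimately show ?case by (simp only:)
    qed
    from function_algebra_expansion[OF _ x_entries subset_refl]
    have "(\<Oplus>\<^bsub>Q\<^esub>s\<in>idx \<times> idx. x s \<odot>\<^bsub>Q\<^esub> delta_function F (idx \<times> idx) s) = restrict x (idx \<times> idx)"
      by (simp cong: restrict_cong)
    also have "\<dots> = x" using x unfolding function_algebra_carrier by (rule PiE_restrict)
    finally show ?thesis using fin[of "idx \<times> idx"] by simp
  qed
  then show "P = carrier B" using PQ by (auto simp: bimodule_simps)
  have "y = \<zero>\<^bsub>Q\<^esub>" if y: "y \<in> N" for y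
  proof (rule Q_eqI)
    fix i j assume ij: "i \<in> idx" "j \<in> idx"
    obtain x where x: "x \<in> P" "x (i, j) \<odot>\<^bsub>Q\<^esub> E i j \<notin> N" using ex[OF ij] by blast
    \<comment> \<open>A nonzero entry of \<open>y\<close> would put every multiple of
      \<open>E i j\<close> into \<open>N\<close>, in particular the one that \<open>x\<close>
      provides outside \<open>N\<close>.\<close>
    have "y (i, j) = \<zero>"
      using submodule_E[OF N y ij _ entry_closed[OF PQ[OF x(1)] ij]] x(2) by blast
    moreover have "\<zero>\<^bsub>Q\<^esub> (i, j) = \<zero>" using ij by (simp add: function_algebra_simps)
    ultimately show "y (i, j) = \<zero>\<^bsub>Q\<^esub> (i, j)" by simp
  qed (auto intro: NQ[OF y])
  moreover have "\<zero>\<^bsub>Q\<^esub> \<in> N" using N.one_closed by (simp add: bimodule_simps)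
  ultimately show "N = {\<zero>\<^bsub>B\<^esub>}" unfolding bimodule_simps by blast
qed

lemma B_minimally_faithful: "minimally_faithful_module R B"
  unfolding minimally_faithful_module_def
proof (intro conjI allI impI B_module B_faithful)
  fix P N
  assume "submodule P R B \<and> submodule N R B \<and> N \<subseteq> P \<and> faithful_module R (module_section B P N)"
  then show "P = carrier B" "N = {\<zero>\<^bsub>B\<^esub>}"
    using B_minimal[of P N] by simp_all
qed

end

theorem proposition6p7:
  fixes F :: "('f, 'r) ring_scheme"
    and n :: nat
    and c :: "nat \<Rightarrow> nat \<Rightarrow> nat \<Rightarrow> 'f"
  assumes "field F"
    and "n \<ge> 1"
    and "reduced_skew_set F n c"
  shows "semiassociative_wrt F (skew_matrix_algebra F n c) (diagonal_subalgebra F n c)"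
proof -
  interpret reduced_skew F n c
    using assms by (intro reduced_skew.intro reduced_skew_axioms.intro)
  show ?thesis
    unfolding semiassociative_wrt_def
    by (intro conjI A_central A_finite_dimensional D_nucleus D_one K_etale B_minimally_faithful)
qed

end
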